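(* Let $\Gamma_1$ and $\Gamma_2$ be fixed negative definite lattices, and let $C>0$ and $D\in\mathbb{Z}$ be constants. Define $\mathcal{L}(\Gamma_1,\Gamma_2;C,D)$ to be the set of negative definite lattices $\Lambda$, up to stable-equivalence, satisfying the following conditions: (i) $\det(\Lambda)=D$; (ii) $\delta(\Lambda)\leq C$; and (iii) $\Gamma_1\oplus\Lambda$ embeds into $\Gamma_2\oplus\langle-1\rangle^N$, where $N=\mathrm{rk}(\Gamma_1)+\mathrm{rk}(\Lambda)-\mathrm{rk}(\Gamma_2)$. Then $\mathcal{L}(\Gamma_1,\Gamma_2;C,D)$ is finite.
   Context: A lattice of rank $n$ is a free abelian group $\mathbb{Z}^n$ with an integer-valued, nondegenerate, symmetric bilinear form; the rank $0$ (empty) lattice is allowed. Its determinant is the determinant of a matrix representing the form in a basis. $\langle-1\rangle$ is the rank one lattice with matrix $[-1]$ and $\langle-1\rangle^m$ is the direct sum of $m$ copies of it. A lattice $\Lambda_1$ embeds into $\Lambda_2$ if there is an injective homomorphism $\Lambda_1\to\Lambda_2$ preserving the bilinear forms. The dual lattice $\Lambda^*=\mathrm{Hom}(\Lambda,\mathbb{Z})$ is identified with $\{\xi\in\Lambda\otimes\mathbb{R}: \xi\cdot w\in\mathbb{Z}\ \text{for all } w\in\Lambda\}$, with the extended form. An element $\xi\in\Lambda^*$ is a characteristic covector if $\xi\cdot w\equiv w\cdot w \pmod 2$ for all $w\in\Lambda$; $\mathrm{Char}(\Lambda)$ is the set of these. For a negative definite lattice $\Lambda$ of rank $n$, $$\delta(\Lambda)=\frac{n-\min_{\xi\in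 \mathrm{Char}(\Lambda)}|\xi\cdot\xi|}{4}.$$ Two negative definite lattices $\Lambda_1,\Lambda_2$ are stable-equivalent if $\Lambda_1\oplus\langle-1\rangle^m\cong\Lambda_2\oplus\langle-1\rangle^n$ for some non-negative integers $m,n$. *)

theory Defs
  imports Complex_Main "Jordan_Normal_Form.Determinant"
begin

(* A lattice structure on the free abelian group Z^n is given by the Gram matrix G of its form in
   the standard basis; the underlying group is carrier_vec n. The 0 x 0 matrix is the empty lattice,
   with determinant 1. The form is polymorphic so that it also serves for the real extension. *)

definition form :: "'a::comm_ring_1 mat \<Rightarrow> 'a vec \<Rightarrow> 'a vec \<Rightarrow> 'a" where
  "form G x y = x \<bullet> (G *\<^sub>v y)"

definition rk :: "int mat \<Rightarrow> nat" where
  "rk G = dim_row G"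

abbreviation lattice_group :: "int mat \<Rightarrow> int vec set" where
  "lattice_group G \<equiv> carrier_vec (rk G)"

definition int_lattice :: "int mat \<Rightarrow> bool" where
  "int_lattice G \<longleftrightarrow>
     square_mat G \<and>
     (\<forall>x\<in>lattice_group G. \<forall>y\<in>lattice_group G. form G x y = form G y x) \<and>
     (\<forall>x\<in>lattice_group G. (\<forall>y\<in>lattice_group G. form G x y = 0) \<longrightarrow> x = 0\<^sub>v (rk G))"

definition neg_def_lattice :: "int mat \<Rightarrow> bool" where
  "neg_def_lattice G \<longleftrightarrow>
     int_lattice G \<and> (\<forall>x\<in>lattice_group G. x \<noteq> 0\<^sub>v (rk G) \<longrightarrow> form G x x < 0)"

definition lattice_sum :: "int mat \<Rightarrow> int mat \<Rightarrow> int mat" (infixr "\<oplus>\<^sub>L" 65) where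
  "A \<oplus>\<^sub>L B = four_block_mat A (0\<^sub>m (rk A) (rk B)) (0\<^sub>m (rk B) (rk A)) B"

definition neg_one :: "int mat" where
  "neg_one = mat 1 1 (\<lambda>_. - 1)"

definition neg_one_pow :: "nat \<Rightarrow> int mat" where
  "neg_one_pow m = diag_block_mat (replicate m neg_one)"

definition form_hom :: "int mat \<Rightarrow> int mat \<Rightarrow> (int vec \<Rightarrow> int vec) \<Rightarrow> bool" where
  "form_hom A B f \<longleftrightarrow>
     f \<in> lattice_group A \<rightarrow> lattice_group B \<and>
     (\<forall>x\<in>lattice_group A. \<forall>y\<in>lattice_group A. f (x + y) = f x + f y) \<and>
     (\<forall>x\<in>lattice_group A. \<forall>y\<in>lattice_group A. form B (f x) (f y) = form A x y)"

definition embeds :: "int mat \<Rightarrow> int mat \<Rightarrow> bool" where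
  "embeds A B \<longleftrightarrow> (\<exists>f. form_hom A B f \<and> inj_on f (lattice_group A))"

definition isometric :: "int mat \<Rightarrow> int mat \<Rightarrow> bool" where
  "isometric A B \<longleftrightarrow> (\<exists>f. form_hom A B f \<and> bij_betw f (lattice_group A) (lattice_group B))"

abbreviation real_form :: "int mat \<Rightarrow> real vec \<Rightarrow> real vec \<Rightarrow> real" where
  "real_form G \<equiv> form (map_mat real_of_int G)"

definition dual_lattice :: "int mat \<Rightarrow> real vec set" where
  "dual_lattice G =
     {\<xi> \<in> carrier_vec (rk G). \<forall>w\<in>lattice_group G. real_form G \<xi> (map_vec real_of_int w) \<in> \<int>}"

definition Char :: "int mat \<Rightarrow> real vec set" where
  "Char G =
     {\<xi> \<in> dual_lattice G. \<forall>w\<in>lattice_group G. \<exists>k::int.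
        real_form G \<xi> (map_vec real_of_int w) - real_of_int (form G w w) = 2 * real_of_int k}"

(* For a negative definite G the values |xi . xi| on Char G form a nonempty set of non-negative
   elements of (1 / det G) Z, so the minimum exists. *)
definition delta :: "int mat \<Rightarrow> real" where
  "delta G = (real (rk G) - (LEAST r. \<exists>\<xi>\<in>Char G. r = \<bar>real_form G \<xi> \<xi>\<bar>)) / 4"

definition stable_equiv :: "(int mat \<times> int mat) set" where
  "stable_equiv =
     {(A, B). neg_def_lattice A \<and> neg_def_lattice B \<and>
              (\<exists>m n. isometric (A \<oplus>\<^sub>L neg_one_pow m) (B \<oplus>\<^sub>L neg_one_pow n))}"

(* The determinant is signed, hence condition (i) is not invariant under stable-equivalence: the
   quotient consists of the classes that contain some lattice satisfying the conditions.
   The equation for N also says that rk G1 + rk L - rk G2 is non-negative. *)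
definition lattice_classes :: "int mat \<Rightarrow> int mat \<Rightarrow> real \<Rightarrow> int \<Rightarrow> int mat set set" where
  "lattice_classes G1 G2 C D =
     {L. neg_def_lattice L \<and>
         det L = D \<and>
         delta L \<le> C \<and>
         (\<exists>N. rk G2 + N = rk G1 + rk L \<and> embeds (G1 \<oplus>\<^sub>L L) (G2 \<oplus>\<^sub>L neg_one_pow N))}
     // stable_equiv"

end

theory Submission
  imports Defs "HOL-Library.Function_Algebras"
begin

text \<open>
  Let \<Lambda> have determinant \<open>D\<close> and \<delta> at most \<open>C\<close>, and let \<open>f\<close> embed \<open>\<Gamma>\<^sub>1 \<oplus> \<Lambda>\<close> into
  \<open>\<Gamma>\<^sub>2 \<oplus> \<langle>-1\<rangle>\<^sup>N\<close>. The ranks agree, so the image \<open>M\<close> of \<open>f\<close> has finite index, and multiplication by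
  \<open>d = \<bar>det \<Gamma>\<^sub>1 \<cdot> D\<bar>\<close>, a number that does not depend on \<Lambda>, maps the target into \<open>M\<close>. The core of the
  proof is a bound, independent of \<Lambda>, on the number \<open>b\<close> of standard basis vectors \<open>e\<^sub>i\<close> of \<open>\<langle>-1\<rangle>\<^sup>N\<close>
  that do not lie in \<open>f(\<Lambda>)\<close>.

  Consider first the \<open>e\<^sub>i\<close> outside \<open>M\<close>. There is a finite family of integral functionals on the target
  such that \<open>M\<close> is the set on which all of them are divisible by \<open>d\<close>, namely the rows of \<open>d\<close> times the
  inverse of the matrix of \<open>f\<close>. The sum of a suitable subfamily is a single functional \<open>q\<close> such that
  \<open>d\<close> divides \<open>q\<close> on \<open>M\<close> but does not divide \<open>q(e\<^sub>i)\<close> for at least half of these \<open>i\<close>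
  (\<open>subset_sum_nonzero_half\<close>). If \<open>p\<close> is a characteristic covector of the target then \<open>p + 2 q / d\<close> is
  characteristic on \<open>M\<close>. Adding even integers to its coordinates brings all of them into \<open>[-1, 1]\<close>,
  and into \<open>[-1 + 1/d, 1 - 1/d]\<close> at the \<open>i\<close> with \<open>q(e\<^sub>i)\<close> not divisible by \<open>d\<close>, because there the
  coordinate is not an odd integer. Its norm is therefore at most \<open>N\<close> plus a constant minus \<open>1/d\<close> for
  each such \<open>i\<close>. Restriction to \<Lambda> is an orthogonal projection and does not increase the norm, while
  \<open>\<delta>(\<Lambda>) \<le> C\<close> forces a characteristic covector of \<Lambda> to have norm at least \<open>rk \<Lambda> - 4 C\<close>, which is \<open>N\<close>
  up to a constant. This bounds the number of \<open>e\<^sub>i\<close> outside \<open>M\<close> (\<open>missing_units_image_S_bound\<close>). An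
  \<open>e\<^sub>i\<close> in \<open>M\<close> but outside \<open>f(\<Lambda>)\<close> occurs in the image of some basis vector of \<open>\<Gamma>\<^sub>1\<close>, and the norms of
  those images limit the number of such \<open>i\<close> (\<open>missing_units_image_L_bound\<close>).

  After a permutation of the \<open>e\<^sub>i\<close>, the image \<open>f(\<Lambda>)\<close> contains every \<open>e\<^sub>i\<close> beyond the first
  \<open>n = rk \<Gamma>\<^sub>2 + b\<close> coordinates, hence it is \<open>X \<oplus> \<langle>-1\<rangle>\<^sup>k\<close> for a sublattice \<open>X\<close> of the first \<open>n\<close>
  coordinates. The pair \<open>(n, X)\<close> determines the stable class (\<open>stable_image_imp_stable_equiv\<close>). Finally
  \<open>X\<close> consists of the vectors of \<open>M\<close> in these coordinates that are orthogonal to \<open>f(\<Gamma>\<^sub>1)\<close>. Membership in \<open>M\<close> depends only on residues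
  modulo \<open>d\<close>, and orthogonality to \<open>f(\<Gamma>\<^sub>1)\<close> is given by linear equations with bounded integer
  coefficients, so only finitely many \<open>X\<close> occur for each \<open>n\<close> (\<open>stable_image_exists\<close>,
  \<open>finite_cong_orth_sets\<close>).
\<close>

section \<open>Gram matrices and direct sums\<close>

lemma scalar_one_mat_mult_vec:
  "x \<in> carrier_vec n \<Longrightarrow> (c \<cdot>\<^sub>m 1\<^sub>m n) *\<^sub>v x = c \<cdot>\<^sub>v (x :: 'a::comm_ring_1 vec)"
  by (intro eq_vecI) (auto simp: row_smult)

lemma of_int_scalar_prod:
  "x \<in> carrier_vec n \<Longrightarrow> y \<in> carrier_vec n \<Longrightarrow>
    map_vec of_int x \<bullet> map_vec of_int y = (of_int (x \<bullet> y) :: 'a::comm_ring_1)"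
  by (simp add: scalar_prod_def carrier_vecD)

lemma mult_mat_vec_smult:
  "A \<in> carrier_mat nr nc \<Longrightarrow> v \<in> carrier_vec nc \<Longrightarrow>
    A *\<^sub>v (c \<cdot>\<^sub>v v) = c \<cdot>\<^sub>v (A *\<^sub>v v :: 'a::comm_ring_1 vec)"
  by (intro eq_vecI) auto

lemma smult_cancel_vec:
  fixes x y :: "int vec"
  assumes "c \<cdot>\<^sub>v x = c \<cdot>\<^sub>v y" "c \<noteq> 0" "x \<in> carrier_vec n" "y \<in> carrier_vec n"
  shows "x = y"
proof (rule eq_vecI)
  fix i assume "i < dim_vec y"
  then have "(c \<cdot>\<^sub>v x) $ i = c * x $ i" "(c \<cdot>\<^sub>v y) $ i = c * y $ i" using assms(3,4) by auto
  then show "x $ i = y $ i" using assms(1,2) by (metis mult_cancel_left)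
qed (use assms in auto)

lemma neg_one_pow_eq: "neg_one_pow m = mat m m (\<lambda>(i, j). if i = j then -1 else 0)"
proof (induction m)
  case 0
  show ?case by (intro eq_matI) (auto simp: neg_one_pow_def)
next
  case (Suc m)
  have "neg_one_pow (Suc m) = four_block_mat neg_one (0\<^sub>m 1 m) (0\<^sub>m m 1) (neg_one_pow m)"
    using Suc by (simp add: neg_one_pow_def Let_def neg_one_def)
  also have "\<dots> = mat (Suc m) (Suc m) (\<lambda>(i, j). if i = j then -1 else 0)"
    unfolding Suc by (intro eq_matI) (auto simp: neg_one_def)
  finally show ?case .
qed

lemma neg_one_pow_index:
  "i < m \<Longrightarrow> j < m \<Longrightarrow> neg_one_pow m $$ (i, j) = (if i = j then -1 else 0)"
  by (simp add: neg_one_pow_eq)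

lemma neg_one_pow_carrier [simp]: "neg_one_pow m \<in> carrier_mat m m"
  by (simp add: neg_one_pow_eq)

lemma rk_neg_one_pow [simp]: "rk (neg_one_pow m) = m"
  by (simp add: neg_one_pow_eq rk_def)

lemma rk_lattice_sum [simp]: "rk (A \<oplus>\<^sub>L B) = rk A + rk B"
  by (simp add: lattice_sum_def rk_def)

lemma lattice_sum_carrier:
  "A \<in> carrier_mat (rk A) (rk A) \<Longrightarrow> B \<in> carrier_mat (rk B) (rk B) \<Longrightarrow>
    A \<oplus>\<^sub>L B \<in> carrier_mat (rk A + rk B) (rk A + rk B)"
  by (simp add: lattice_sum_def)

lemma neg_one_pow_add: "neg_one_pow (m + n) = neg_one_pow m \<oplus>\<^sub>L neg_one_pow n"
  by (intro eq_matI) (auto simp: neg_one_pow_eq lattice_sum_def rk_def)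

lemma lattice_sum_assoc:
  assumes "A \<in> carrier_mat (rk A) (rk A)" "B \<in> carrier_mat (rk B) (rk B)"
    "C \<in> carrier_mat (rk C) (rk C)"
  shows "A \<oplus>\<^sub>L B \<oplus>\<^sub>L C = (A \<oplus>\<^sub>L B) \<oplus>\<^sub>L C"
proof -
  have "dim_col A = dim_row A" "dim_col B = dim_row B" "dim_col C = dim_row C"
    using assms by (auto simp only: rk_def carrier_mat_def mem_Collect_eq)
  then show ?thesis using assoc_four_block_mat[of A B C] by (simp add: lattice_sum_def rk_def)
qed

lemma form_append:
  assumes A: "A \<in> carrier_mat (rk A) (rk A)" and B: "B \<in> carrier_mat (rk B) (rk B)"
    and x: "x \<in> lattice_group A" "x' \<in> lattice_group A"
    and y: "y \<in> lattice_group B" "y' \<in> lattice_group B"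
  shows "form (A \<oplus>\<^sub>L B) (x @\<^sub>v y) (x' @\<^sub>v y') = form A x x' + form B y y'"
  unfolding form_def lattice_sum_def mult_mat_vec_split[OF A B x(2) y(2)]
  by (rule scalar_prod_append) (use A B x y in auto)

lemma form_neg_one_pow:
  assumes "x \<in> carrier_vec m" "y \<in> carrier_vec m"
  shows "form (neg_one_pow m) x y = - (x \<bullet> y)"
proof -
  have "neg_one_pow m *\<^sub>v y = - y"
    using assms by (intro eq_vecI) (auto simp: neg_one_pow_eq scalar_prod_def
        if_distrib[where f = "\<lambda>c. c * _"] sum.delta cong: if_cong)
  then show ?thesis using assms by (simp add: form_def)
qed

context
  fixes G :: "'a::comm_ring_1 mat" and n :: nat
  assumes G: "G \<in> carrier_mat n n"
begin

lemma form_add_left: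
  "x \<in> carrier_vec n \<Longrightarrow> y \<in> carrier_vec n \<Longrightarrow> z \<in> carrier_vec n \<Longrightarrow>
    form G (x + y) z = form G x z + form G y z"
  using G by (simp add: form_def add_scalar_prod_distrib[of _ n])

lemma form_add_right:
  "x \<in> carrier_vec n \<Longrightarrow> y \<in> carrier_vec n \<Longrightarrow> z \<in> carrier_vec n \<Longrightarrow>
    form G x (y + z) = form G x y + form G x z"
  using G by (simp add: form_def mult_add_distrib_mat_vec[of _ n n] scalar_prod_add_distrib[of _ n])

lemma form_minus_left:
  "x \<in> carrier_vec n \<Longrightarrow> y \<in> carrier_vec n \<Longrightarrow> z \<in> carrier_vec n \<Longrightarrow>
    form G (x - y) z = form G x z - form G y z"
  using G by (simp add: form_def minus_scalar_prod_distrib[of _ n])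

lemma form_minus_right:
  "x \<in> carrier_vec n \<Longrightarrow> y \<in> carrier_vec n \<Longrightarrow> z \<in> carrier_vec n \<Longrightarrow>
    form G x (y - z) = form G x y - form G x z"
  using G by (simp add: form_def mult_minus_distrib_mat_vec[of _ n n] scalar_prod_minus_distrib[of _ n])

lemma form_smult_left:
  "x \<in> carrier_vec n \<Longrightarrow> y \<in> carrier_vec n \<Longrightarrow> form G (c \<cdot>\<^sub>v x) y = c * form G x y"
  using G by (simp add: form_def)

lemma form_smult_right:
  "x \<in> carrier_vec n \<Longrightarrow> y \<in> carrier_vec n \<Longrightarrow> form G x (c \<cdot>\<^sub>v y) = c * form G x y"
  using G by (simp add: form_def scalar_prod_def sum_distrib_left carrier_vecD mult.left_commute)

lemma form_unit_left: "i < n \<Longrightarrow> y \<in> carrier_vec n \<Longrightarrow> form G (unit_vec n i) y = (G *\<^sub>v y) $ i"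
  using G by (simp add: form_def)

lemma form_unit_unit:
  "i < n \<Longrightarrow> j < n \<Longrightarrow> form G (unit_vec n i) (unit_vec n j) = G $$ (i, j)"
  using G by (simp add: form_unit_left)

lemma form_eq_sum:
  "x \<in> carrier_vec n \<Longrightarrow> y \<in> carrier_vec n \<Longrightarrow>
    form G x y = (\<Sum>i<n. \<Sum>j<n. x $ i * G $$ (i, j) * y $ j)"
  using G by (simp add: form_def scalar_prod_def sum_distrib_left mult.assoc lessThan_atLeast0
      carrier_vecD)

end

lemma form_congruence:
  fixes T P :: "'a::comm_ring_1 mat"
  assumes T: "T \<in> carrier_mat m m" and P: "P \<in> carrier_mat m n"
    and x: "x \<in> carrier_vec n" and y: "y \<in> carrier_vec n"
  shows "form T (P *\<^sub>v x) (P *\<^sub>v y) = form (transpose_mat P * (T * P)) x y"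
proof -
  have Px: "P *\<^sub>v x \<in> carrier_vec m" and Py: "P *\<^sub>v y \<in> carrier_vec m"
    using P x y by (auto intro: mult_mat_vec_carrier)
  then have TPy: "T *\<^sub>v (P *\<^sub>v y) \<in> carrier_vec m" using T by (auto intro: mult_mat_vec_carrier)
  have "form T (P *\<^sub>v x) (P *\<^sub>v y) = (transpose_mat P *\<^sub>v (T *\<^sub>v (P *\<^sub>v y))) \<bullet> x"
    unfolding form_def comm_scalar_prod[OF Px TPy] transpose_vec_mult_scalar[OF P x TPy] ..
  also have "transpose_mat P *\<^sub>v (T *\<^sub>v (P *\<^sub>v y)) = (transpose_mat P * (T * P)) *\<^sub>v y"
    using P T y by (simp add: assoc_mult_mat_vec[of _ n m _ n] assoc_mult_mat_vec[of _ m m _ n])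
  also have "\<dots> \<bullet> x = form (transpose_mat P * (T * P)) x y"
    unfolding form_def by (rule comm_scalar_prod[of _ n]) (use P x y in \<open>auto intro!: mult_mat_vec_carrier\<close>)
  finally show ?thesis .
qed

lemma neg_def_lattice_carrier:
  assumes "neg_def_lattice G"
  shows "G \<in> carrier_mat (rk G) (rk G)"
  using assms by (auto simp: neg_def_lattice_def int_lattice_def rk_def)

lemma neg_def_lattice_form_commute:
  "neg_def_lattice G \<Longrightarrow> x \<in> lattice_group G \<Longrightarrow> y \<in> lattice_group G \<Longrightarrow>
    form G x y = form G y x"
  by (auto simp: neg_def_lattice_def int_lattice_def)

lemma neg_def_lattice_nonpos:
  assumes "neg_def_lattice G" "x \<in> lattice_group G"
  shows "form G x x \<le> 0"
proof (cases "x = 0\<^sub>v (rk G)")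
  case True
  then show ?thesis using neg_def_lattice_carrier[OF assms(1)] by (simp add: form_def)
next
  case False
  then show ?thesis using assms by (force simp: neg_def_lattice_def)
qed

lemma neg_def_lattice_form_eq_0:
  "neg_def_lattice G \<Longrightarrow> x \<in> lattice_group G \<Longrightarrow> form G x x = 0 \<Longrightarrow> x = 0\<^sub>v (rk G)"
  by (force simp: neg_def_lattice_def)

lemma neg_def_latticeI:
  assumes "G \<in> carrier_mat (rk G) (rk G)"
    and "\<And>x y. x \<in> lattice_group G \<Longrightarrow> y \<in> lattice_group G \<Longrightarrow> form G x y = form G y x"
    and neg: "\<And>x. x \<in> lattice_group G \<Longrightarrow> x \<noteq> 0\<^sub>v (rk G) \<Longrightarrow> form G x x < 0"
  shows "neg_def_lattice G"
proof -
  have "square_mat G" using assms(1) by simp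
  moreover have "x = 0\<^sub>v (rk G)"
    if "x \<in> lattice_group G" "\<forall>y\<in>lattice_group G. form G x y = 0" for x
    using neg[of x] that by fastforce
  ultimately show ?thesis using assms by (auto simp: neg_def_lattice_def int_lattice_def)
qed

lemma neg_def_lattice_transpose:
  assumes "neg_def_lattice G"
  shows "transpose_mat G = G"
proof (rule eq_matI)
  fix i j assume ij: "i < dim_row G" "j < dim_col G"
  note G = neg_def_lattice_carrier[OF assms]
  show "transpose_mat G $$ (i, j) = G $$ (i, j)"
    using neg_def_lattice_form_commute[OF assms, of "unit_vec (rk G) i" "unit_vec (rk G) j"] ij G
    by (simp add: form_unit_unit[OF G])
qed (use neg_def_lattice_carrier[OF assms] in auto)

lemma neg_def_lattice_det_nonzero:
  assumes "neg_def_lattice G"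
  shows "det G \<noteq> 0"
proof
  assume "det G = 0"
  then obtain v where v: "v \<in> carrier_vec (rk G)" "v \<noteq> 0\<^sub>v (rk G)" "G *\<^sub>v v = 0\<^sub>v (rk G)"
    using det_0_iff_vec_prod_zero[OF neg_def_lattice_carrier[OF assms]] by auto
  then show False using neg_def_lattice_form_eq_0[OF assms v(1)] by (simp add: form_def)
qed

lemma neg_def_lattice_sum:
  assumes "neg_def_lattice A" "neg_def_lattice B"
  shows "neg_def_lattice (A \<oplus>\<^sub>L B)"
proof (rule neg_def_latticeI)
  note A = neg_def_lattice_carrier[OF assms(1)]
  note B = neg_def_lattice_carrier[OF assms(2)]
  show "A \<oplus>\<^sub>L B \<in> carrier_mat (rk (A \<oplus>\<^sub>L B)) (rk (A \<oplus>\<^sub>L B))"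
    using lattice_sum_carrier[OF A B] by simp
  have form_split: "form (A \<oplus>\<^sub>L B) x y =
      form A (vec_first x (rk A)) (vec_first y (rk A)) + form B (vec_last x (rk B)) (vec_last y (rk B))"
    if "x \<in> lattice_group (A \<oplus>\<^sub>L B)" "y \<in> lattice_group (A \<oplus>\<^sub>L B)" for x y
    using that form_append[OF A B, of "vec_first x (rk A)" "vec_first y (rk A)"
        "vec_last x (rk B)" "vec_last y (rk B)"] by simp
  show "form (A \<oplus>\<^sub>L B) x y = form (A \<oplus>\<^sub>L B) y x"
    if "x \<in> lattice_group (A \<oplus>\<^sub>L B)" "y \<in> lattice_group (A \<oplus>\<^sub>L B)" for x y
    using that form_split neg_def_lattice_form_commute[OF assms(1)]
      neg_def_lattice_form_commute[OF assms(2)] by simp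
  show "form (A \<oplus>\<^sub>L B) x x < 0"
    if x: "x \<in> lattice_group (A \<oplus>\<^sub>L B)" "x \<noteq> 0\<^sub>v (rk (A \<oplus>\<^sub>L B))" for x
  proof (rule ccontr)
    let ?a = "vec_first x (rk A)" and ?b = "vec_last x (rk B)"
    assume "\<not> form (A \<oplus>\<^sub>L B) x x < 0"
    then have "form A ?a ?a = 0" "form B ?b ?b = 0"
      using form_split[OF x(1) x(1)] neg_def_lattice_nonpos[OF assms(1), of ?a]
        neg_def_lattice_nonpos[OF assms(2), of ?b] by auto
    then have "?a = 0\<^sub>v (rk A)" "?b = 0\<^sub>v (rk B)"
      using neg_def_lattice_form_eq_0 assms by auto
    moreover have "?a @\<^sub>v ?b = x" using x(1) by simp
    ultimately show False using x(2) by auto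
  qed
qed

lemma neg_def_lattice_neg_one_pow: "neg_def_lattice (neg_one_pow m)"
proof (rule neg_def_latticeI)
  show "form (neg_one_pow m) x x < 0"
    if x: "x \<in> lattice_group (neg_one_pow m)" "x \<noteq> 0\<^sub>v (rk (neg_one_pow m))" for x
  proof -
    from x obtain i where i: "i < m" "x $ i \<noteq> 0" by (auto simp: vec_eq_iff)
    have "0 < (\<Sum>i<m. x $ i * x $ i)"
      using i by (intro sum_pos2[of _ i]) (auto simp: zero_less_mult_iff)
    then show ?thesis using x by (simp add: form_neg_one_pow scalar_prod_def lessThan_atLeast0
          carrier_vecD)
  qed
qed (auto simp: form_neg_one_pow intro: comm_scalar_prod)

lemma det_lattice_sum:
  assumes "neg_def_lattice A" "neg_def_lattice B"
  shows "det (A \<oplus>\<^sub>L B) = det A * det B"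
  unfolding lattice_sum_def
  by (rule det_four_block_mat_upper_right_zero)
    (use neg_def_lattice_carrier assms in auto)

section \<open>Isometry and stable equivalence\<close>

text \<open>
  Isometries are compared through images in a common group: this avoids choosing bases of sublattices,
  and it is how a stable class will be read off from an image.
\<close>

lemma isometricI_common_image:
  fixes h :: "int vec \<Rightarrow> 'b::plus" and q :: "'b \<Rightarrow> 'b \<Rightarrow> int"
  assumes add: "\<And>x y. x \<in> lattice_group A \<Longrightarrow> y \<in> lattice_group A \<Longrightarrow> h (x + y) = h x + h y"
      "\<And>x y. x \<in> lattice_group B \<Longrightarrow> y \<in> lattice_group B \<Longrightarrow> k (x + y) = k x + k y"
    and form: "\<And>x y. x \<in> lattice_group A \<Longrightarrow> y \<in> lattice_group A \<Longrightarrow> q (h x) (h y) = form A x y"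
      "\<And>x y. x \<in> lattice_group B \<Longrightarrow> y \<in> lattice_group B \<Longrightarrow> q (k x) (k y) = form B x y"
    and inj: "inj_on h (lattice_group A)" "inj_on k (lattice_group B)"
    and image: "h ` lattice_group A = k ` lattice_group B"
  shows "isometric A B"
proof -
  let ?f = "\<lambda>x. inv_into (lattice_group B) k (h x)"
  have f: "?f x \<in> lattice_group B" "k (?f x) = h x" if "x \<in> lattice_group A" for x
  proof -
    from that image have "h x \<in> k ` lattice_group B" by blast
    then show "?f x \<in> lattice_group B" "k (?f x) = h x"
      by (auto intro: inv_into_into f_inv_into_f)
  qed
  have "?f (x + y) = ?f x + ?f y" if "x \<in> lattice_group A" "y \<in> lattice_group A" for x y
  proof (rule inj_onD[OF inj(2)])
    have xy: "x + y \<in> lattice_group A" using that by simp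
    show "k (?f (x + y)) = k (?f x + ?f y)"
      using f[OF xy] f[OF that(1)] f[OF that(2)] add(1)[OF that] add(2)[of "?f x" "?f y"] by simp
    show "?f (x + y) \<in> lattice_group B" by (rule f[OF xy])
    show "?f x + ?f y \<in> lattice_group B" using f that by simp
  qed
  moreover have "form B (?f x) (?f y) = form A x y"
    if "x \<in> lattice_group A" "y \<in> lattice_group A" for x y
    using that f form by metis
  ultimately have "form_hom A B ?f" using f by (auto simp: form_hom_def)
  moreover have "bij_betw ?f (lattice_group A) (lattice_group B)"
  proof -
    have "bij_betw h (lattice_group A) (k ` lattice_group B)"
      using inj(1) image by (simp add: bij_betw_def)
    moreover have "bij_betw (inv_into (lattice_group B) k) (k ` lattice_group B) (lattice_group B)"
      using inj(2) by (intro bij_betw_inv_into) (simp add: bij_betw_def)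
    ultimately have "bij_betw (inv_into (lattice_group B) k \<circ> h) (lattice_group A) (lattice_group B)"
      by (rule bij_betw_trans)
    then show ?thesis by (simp add: comp_def)
  qed
  ultimately show ?thesis by (auto simp: isometric_def)
qed

lemma isometric_sym:
  assumes "isometric A B"
  shows "isometric B A"
proof -
  obtain f where f: "form_hom A B f" "bij_betw f (lattice_group A) (lattice_group B)"
    using assms by (auto simp: isometric_def)
  show ?thesis
    by (rule isometricI_common_image[where h = "\<lambda>x. x" and k = f and q = "form B"])
      (use f in \<open>auto simp: form_hom_def bij_betw_def\<close>)
qed

lemma isometric_trans:
  assumes "isometric A B" "isometric B C"
  shows "isometric A C"
proof -
  obtain f where f: "form_hom A B f" "bij_betw f (lattice_group A) (lattice_group B)"
    using assms by (auto simp: isometric_def)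
  obtain g where g: "form_hom B C g" "bij_betw g (lattice_group B) (lattice_group C)"
    using assms by (auto simp: isometric_def)
  have fB: "f x \<in> lattice_group B" if "x \<in> lattice_group A" for x
    using f that by (auto simp: form_hom_def)
  have "form_hom A C (g \<circ> f)" using f g fB by (auto simp: form_hom_def)
  then show ?thesis using bij_betw_trans[OF f(2) g(2)] by (auto simp: isometric_def)
qed

lemma isometric_sum_right:
  assumes carrier: "A \<in> carrier_mat (rk A) (rk A)" "B \<in> carrier_mat (rk B) (rk B)"
      "C \<in> carrier_mat (rk C) (rk C)"
    and "isometric A B"
  shows "isometric (A \<oplus>\<^sub>L C) (B \<oplus>\<^sub>L C)"
proof -
  obtain f where f: "form_hom A B f" "bij_betw f (lattice_group A) (lattice_group B)"
    using assms by (auto simp: isometric_def)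
  have fB: "f x \<in> lattice_group B" if "x \<in> lattice_group A" for x
    using f that by (auto simp: form_hom_def)
  let ?h = "\<lambda>x. f (vec_first x (rk A)) @\<^sub>v vec_last x (rk C)"
  have first_add: "vec_first (x + y) n = vec_first x n + vec_first y n"
    if "x \<in> carrier_vec (n + m)" "y \<in> carrier_vec (n + m)" for x y :: "int vec" and n m
    using that by (auto simp: vec_first_def)
  have last_add: "vec_last (x + y) m = vec_last x m + vec_last y m"
    if "x \<in> carrier_vec (n + m)" "y \<in> carrier_vec (n + m)" for x y :: "int vec" and n m
    using that by (auto simp: vec_last_def)
  show ?thesis
  proof (rule isometricI_common_image[where h = ?h and k = "\<lambda>x. x" and q = "form (B \<oplus>\<^sub>L C)"])
    fix x y assume xy: "x \<in> lattice_group (A \<oplus>\<^sub>L C)" "y \<in> lattice_group (A \<oplus>\<^sub>L C)"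
    show "?h (x + y) = ?h x + ?h y"
      using xy f fB append_vec_add[of "f (vec_first x (rk A))" "rk B" "f (vec_first y (rk A))"
          "vec_last x (rk C)" "rk C" "vec_last y (rk C)"]
      by (simp add: first_add last_add form_hom_def)
    have "form (A \<oplus>\<^sub>L C) x y = form A (vec_first x (rk A)) (vec_first y (rk A))
        + form C (vec_last x (rk C)) (vec_last y (rk C))"
      using xy form_append[OF carrier(1,3), of "vec_first x (rk A)" "vec_first y (rk A)"
          "vec_last x (rk C)" "vec_last y (rk C)"] by simp
    then show "form (B \<oplus>\<^sub>L C) (?h x) (?h y) = form (A \<oplus>\<^sub>L C) x y"
      using f fB by (simp add: form_append[OF carrier(2,3)] form_hom_def)
  next
    show "inj_on ?h (lattice_group (A \<oplus>\<^sub>L C))"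
    proof (rule inj_onI)
      fix x y assume xy: "x \<in> lattice_group (A \<oplus>\<^sub>L C)" "y \<in> lattice_group (A \<oplus>\<^sub>L C)" "?h x = ?h y"
      have "f (vec_first x (rk A)) = f (vec_first y (rk A)) \<and> vec_last x (rk C) = vec_last y (rk C)"
        using xy(3) append_vec_eq[OF fB fB] by auto
      then have "vec_first x (rk A) = vec_first y (rk A)" "vec_last x (rk C) = vec_last y (rk C)"
        using inj_onD[OF bij_betw_imp_inj_on[OF f(2)]] by auto
      then show "x = y" using xy vec_first_last_append[of _ "rk A" "rk C"]
        by (metis rk_lattice_sum)
    qed
    show "?h ` lattice_group (A \<oplus>\<^sub>L C) = (\<lambda>x. x) ` lattice_group (B \<oplus>\<^sub>L C)"
    proof (safe)
      fix x :: "int vec" assume "x \<in> lattice_group (A \<oplus>\<^sub>L C)"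
      then show "?h x \<in> (\<lambda>x. x) ` lattice_group (B \<oplus>\<^sub>L C)" using fB by auto
    next
      fix y :: "int vec" assume y: "y \<in> lattice_group (B \<oplus>\<^sub>L C)"
      obtain a where a: "a \<in> lattice_group A" "f a = vec_first y (rk B)"
        using bij_betw_imp_surj_on[OF f(2)] vec_first_carrier[of y "rk B"] by (metis imageE)
      have "vec_first (a @\<^sub>v vec_last y (rk C)) (rk A) = a"
        "vec_last (a @\<^sub>v vec_last y (rk C)) (rk C) = vec_last y (rk C)"
        using a by (auto simp: vec_first_def vec_last_def)
      then have "?h (a @\<^sub>v vec_last y (rk C)) = y"
        using a y by simp
      moreover have "a @\<^sub>v vec_last y (rk C) \<in> lattice_group (A \<oplus>\<^sub>L C)"
        using a by simp
      ultimately show "y \<in> ?h ` lattice_group (A \<oplus>\<^sub>L C)"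
        by (intro image_eqI[where x = "a @\<^sub>v vec_last y (rk C)"]) simp_all
    qed
  qed auto
qed

lemma sym_stable_equiv: "(A, B) \<in> stable_equiv \<Longrightarrow> (B, A) \<in> stable_equiv"
  using isometric_sym by (auto simp: stable_equiv_def)

lemma trans_stable_equiv:
  assumes "(A, B) \<in> stable_equiv" "(B, C) \<in> stable_equiv"
  shows "(A, C) \<in> stable_equiv"
proof -
  obtain m n where mn: "isometric (A \<oplus>\<^sub>L neg_one_pow m) (B \<oplus>\<^sub>L neg_one_pow n)"
    using assms by (auto simp: stable_equiv_def)
  obtain p q where pq: "isometric (B \<oplus>\<^sub>L neg_one_pow p) (C \<oplus>\<^sub>L neg_one_pow q)"
    using assms by (auto simp: stable_equiv_def)
  have nd: "neg_def_lattice A" "neg_def_lattice B" "neg_def_lattice C"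
    using assms by (auto simp: stable_equiv_def)
  have assoc: "(X \<oplus>\<^sub>L neg_one_pow i) \<oplus>\<^sub>L neg_one_pow j = X \<oplus>\<^sub>L neg_one_pow (i + j)"
    if "neg_def_lattice X" for X i j
    using lattice_sum_assoc[of X "neg_one_pow i" "neg_one_pow j"] neg_def_lattice_carrier[OF that]
    by (simp add: neg_one_pow_add)
  have add: "isometric (X \<oplus>\<^sub>L neg_one_pow (i + k)) (Y \<oplus>\<^sub>L neg_one_pow (j + k))"
    if "neg_def_lattice X" "neg_def_lattice Y" "isometric (X \<oplus>\<^sub>L neg_one_pow i) (Y \<oplus>\<^sub>L neg_one_pow j)"
    for X Y i j k
    using isometric_sum_right[OF _ _ _ that(3), of "neg_one_pow k"]
      lattice_sum_carrier[of X "neg_one_pow i"] lattice_sum_carrier[of Y "neg_one_pow j"]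
      neg_def_lattice_carrier[OF that(1)] neg_def_lattice_carrier[OF that(2)]
    by (simp add: assoc that)
  have "isometric (A \<oplus>\<^sub>L neg_one_pow (m + p)) (C \<oplus>\<^sub>L neg_one_pow (q + n))"
    using isometric_trans[OF add[OF nd(1,2) mn, of p]] add[OF nd(2,3) pq, of n]
    by (simp add: add.commute)
  then show ?thesis using nd by (auto simp: stable_equiv_def)
qed

lemma stable_equiv_class_eq:
  assumes "(A, B) \<in> stable_equiv"
  shows "stable_equiv `` {A} = stable_equiv `` {B}"
proof (rule Set.set_eqI)
  fix X
  show "X \<in> stable_equiv `` {A} \<longleftrightarrow> X \<in> stable_equiv `` {B}"
    using trans_stable_equiv[OF assms, of X] trans_stable_equiv[OF sym_stable_equiv[OF assms], of X]
    by auto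
qed

section \<open>Norms of characteristic covectors\<close>

text \<open>
  On a set of reals without a minimum, \<open>LEAST\<close> is an arbitrary value. Here the values lie in
  \<open>(1/c) \<nat>\<close>, which is well ordered.
\<close>

lemma Least_of_discrete_values:
  fixes V :: "real set" and c :: real
  assumes "c > 0" and vals: "\<And>r. r \<in> V \<Longrightarrow> c * r \<in> \<nat>" and "x \<in> V"
  shows "(LEAST r. r \<in> V) \<le> x"
proof -
  define k where "k = (LEAST k. \<exists>r\<in>V. c * r = of_nat k)"
  have "\<exists>r\<in>V. c * r = of_nat k"
    unfolding k_def by (rule LeastI_ex) (use vals[OF assms(3)] assms(3) in \<open>auto elim!: Nats_cases\<close>)
  then obtain r where r: "r \<in> V" "c * r = of_nat k" by blast
  have min: "r \<le> s" if s: "s \<in> V" for s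
  proof -
    obtain l where l: "c * s = of_nat l" using vals[OF s] by (auto elim: Nats_cases)
    then have "k \<le> l" unfolding k_def using s by (intro Least_le) auto
    then show ?thesis using l r \<open>c > 0\<close> by (metis mult_le_cancel_left_pos of_nat_le_iff)
  qed
  then have "(LEAST r. r \<in> V) = r" using r(1) by (intro Least_equality)
  then show ?thesis using min assms(3) by simp
qed

text \<open>
  For a dual vector \<eta> the vector \<open>G \<eta>\<close> is integral, hence by Cramer's rule so is \<open>det G \<cdot> \<eta>\<close>. The norms of
  dual vectors therefore lie in \<open>(1/det G) \<int>\<close>, and the minimum in the definition of \<open>delta\<close> is attained.
\<close>

lemma delta_Char_bound:
  assumes G: "neg_def_lattice G" and "\<xi> \<in> Char G"
  shows "real (rk G) - 4 * delta G \<le> \<bar>real_form G \<xi> \<xi>\<bar>"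
proof -
  let ?R = "map_mat real_of_int" and ?n = "rk G"
  note Gc = neg_def_lattice_carrier[OF G]
  define V where "V = {r. \<exists>\<xi>\<in>Char G. r = \<bar>real_form G \<xi> \<xi>\<bar>}"
  have "\<bar>real_of_int (det G)\<bar> * r \<in> \<nat>" if "r \<in> V" for r
  proof -
    obtain \<eta> where \<eta>: "\<eta> \<in> Char G" and r: "r = \<bar>real_form G \<eta> \<eta>\<bar>" using \<open>r \<in> V\<close> V_def by auto
    have \<eta>c: "\<eta> \<in> carrier_vec ?n" using \<eta> by (simp add: Char_def dual_lattice_def)
    define w where "w = ?R G *\<^sub>v \<eta>"
    have wc: "w \<in> carrier_vec ?n" using mult_mat_vec_carrier[of "?R G" ?n ?n \<eta>] Gc \<eta>c by (simp add: w_def)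
    have RG: "?R G \<in> carrier_mat ?n ?n" using Gc by simp
    have sym: "transpose_mat (?R G) = ?R G"
      using neg_def_lattice_transpose[OF G] by (metis map_mat_transpose)
    have w_int: "w $ i \<in> \<int>" if "i < ?n" for i
    proof -
      have "real_form G \<eta> (map_vec real_of_int (unit_vec ?n i)) \<in> \<int>"
        using \<eta> by (auto simp: Char_def dual_lattice_def)
      moreover have "map_vec real_of_int (unit_vec ?n i) = unit_vec ?n i"
        by (auto simp: vec_eq_iff unit_vec_def)
      moreover have "real_form G \<eta> (unit_vec ?n i) = (transpose_mat (?R G) *\<^sub>v \<eta>) \<bullet> unit_vec ?n i"
        using transpose_vec_mult_scalar[OF RG unit_vec_carrier \<eta>c] by (simp add: form_def)
      ultimately show ?thesis using wc that by (simp add: sym w_def[symmetric])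
    qed
    have adj: "adj_mat G \<in> carrier_mat ?n ?n" "adj_mat G * G = det G \<cdot>\<^sub>m 1\<^sub>m ?n"
      using adj_mat[OF Gc] by auto
    have "real_of_int (det G) \<cdot>\<^sub>v \<eta> = (?R (adj_mat G) * ?R G) *\<^sub>v \<eta>"
    proof -
      have "?R (adj_mat G) * ?R G = ?R (adj_mat G * G)"
        by (rule of_int_hom.mat_hom_mult[OF adj(1) Gc, symmetric])
      also have "\<dots> = real_of_int (det G) \<cdot>\<^sub>m 1\<^sub>m ?n"
        unfolding adj(2) by (intro eq_matI) auto
      finally show ?thesis using \<eta>c by (simp add: scalar_one_mat_mult_vec)
    qed
    also have "\<dots> = ?R (adj_mat G) *\<^sub>v w"
      unfolding w_def using assoc_mult_mat_vec[of "?R (adj_mat G)" ?n ?n "?R G" ?n \<eta>] adj Gc \<eta>c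
      by simp
    finally have det_\<eta>: "real_of_int (det G) \<cdot>\<^sub>v \<eta> = ?R (adj_mat G) *\<^sub>v w" .
    have "real_of_int (det G) * real_form G \<eta> \<eta> = (real_of_int (det G) \<cdot>\<^sub>v \<eta>) \<bullet> w"
      using \<eta>c wc by (simp add: form_def w_def)
    also have "\<dots> \<in> \<int>"
      unfolding det_\<eta> using w_int wc adj
      by (auto simp: scalar_prod_def intro!: Ints_sum Ints_mult)
    finally have "\<bar>real_of_int (det G)\<bar> * r \<in> \<int>"
      unfolding r by (metis Ints_abs abs_mult)
    then show ?thesis using r by (auto simp: Nats_altdef2)
  qed
  then have "(LEAST r. r \<in> V) \<le> \<bar>real_form G \<xi> \<xi>\<bar>"
    using neg_def_lattice_det_nonzero[OF G] assms(2)
    by (intro Least_of_discrete_values[of "\<bar>real_of_int (det G)\<bar>"]) (auto simp: V_def)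
  then show ?thesis by (simp add: delta_def V_def field_simps)
qed

text \<open>
  A fraction-free form of the lower bound: the integer vector \<open>w\<close> represents the functional \<open>w / d\<close>, whose
  dual vector is \<open>adj G w / (d det G)\<close>.
\<close>

lemma delta_integral_covector_bound:
  assumes G: "neg_def_lattice G" and w: "w \<in> lattice_group G" and "d > 0"
    and char: "\<And>v. v \<in> lattice_group G \<Longrightarrow> 2 * d dvd w \<bullet> v - d * form G v v"
  shows "real (rk G) - 4 * delta G \<le>
    \<bar>real_of_int (w \<bullet> (adj_mat G *\<^sub>v w)) / (real_of_int d ^ 2 * real_of_int (det G))\<bar>"
proof -
  let ?R = "map_mat real_of_int" and ?n = "rk G" and ?r = "map_vec real_of_int"
  note Gc = neg_def_lattice_carrier[OF G]
  have adj: "adj_mat G \<in> carrier_mat ?n ?n" "G * adj_mat G = det G \<cdot>\<^sub>m 1\<^sub>m ?n"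
    using adj_mat[OF Gc] by auto
  define y where "y = adj_mat G *\<^sub>v w"
  have yc: "y \<in> carrier_vec ?n" using mult_mat_vec_carrier[OF adj(1) w] by (simp add: y_def)
  have Gy: "G *\<^sub>v y = det G \<cdot>\<^sub>v w"
  proof -
    have "G *\<^sub>v y = (G * adj_mat G) *\<^sub>v w"
      unfolding y_def using assoc_mult_mat_vec[OF Gc adj(1) w] by simp
    then show ?thesis using w by (simp add: adj(2) scalar_one_mat_mult_vec)
  qed
  define c where "c = 1 / (real_of_int d * real_of_int (det G))"
  define \<xi> where "\<xi> = c \<cdot>\<^sub>v ?r y"
  have \<xi>c: "\<xi> \<in> carrier_vec ?n" using yc by (simp add: \<xi>_def)
  have RG: "?R G \<in> carrier_mat ?n ?n" using Gc by simp
  have c: "c * real_of_int (det G) = 1 / real_of_int d"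
    using neg_def_lattice_det_nonzero[OF G] by (simp add: c_def)
  have pair: "real_form G \<xi> (?r v) = real_of_int (w \<bullet> v) / real_of_int d"
    if v: "v \<in> lattice_group G" for v
  proof -
    have "real_form G \<xi> (?r v) = c * real_of_int (y \<bullet> (G *\<^sub>v v))"
      using yc v Gc of_int_hom.mult_mat_vec_hom[OF Gc v, where ?'a = real]
        of_int_scalar_prod[OF yc mult_mat_vec_carrier[OF Gc v], where ?'a = real]
      by (simp add: form_def \<xi>_def)
    also have "y \<bullet> (G *\<^sub>v v) = (G *\<^sub>v y) \<bullet> v"
      using transpose_vec_mult_scalar[OF Gc v yc] neg_def_lattice_transpose[OF G] by simp
    also have "\<dots> = det G * (w \<bullet> v)" using w v by (simp add: Gy)
    finally show ?thesis using c by (simp flip: mult.assoc)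
  qed
  have "real_form G \<xi> \<xi> = c * real_form G \<xi> (?r y)"
    using form_smult_right[OF RG \<xi>c, of "?r y" c] yc by (simp add: \<xi>_def)
  also have "\<dots> = real_of_int (w \<bullet> y) / (real_of_int d ^ 2 * real_of_int (det G))"
    using pair[OF yc] by (simp add: c_def power2_eq_square)
  finally have norm: "real_form G \<xi> \<xi> = \<dots>" .
  have ex: "\<exists>k. real_form G \<xi> (?r v) - real_of_int (form G v v) = 2 * real_of_int k"
    if v: "v \<in> lattice_group G" for v
  proof -
    from char[OF v] obtain k where "w \<bullet> v - d * form G v v = 2 * d * k" by (elim dvdE)
    then have "w \<bullet> v = d * (form G v v + 2 * k)" by (simp add: algebra_simps)
    then have "real_of_int (w \<bullet> v) = real_of_int d * (real_of_int (form G v v) + 2 * real_of_int k)"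
      by simp
    then show ?thesis using \<open>d > 0\<close> pair[OF v] by (intro exI[of _ k]) simp
  qed
  have "real_form G \<xi> (?r v) \<in> \<int>" if v: "v \<in> lattice_group G" for v
  proof -
    obtain k where "real_form G \<xi> (?r v) - real_of_int (form G v v) = 2 * real_of_int k"
      using ex[OF v] by blast
    then have "real_form G \<xi> (?r v) = real_of_int (form G v v + 2 * k)" by simp
    then show ?thesis by (metis Ints_of_int)
  qed
  then have "\<xi> \<in> Char G" using ex \<xi>c by (auto simp: Char_def dual_lattice_def)
  from delta_Char_bound[OF G this] show ?thesis unfolding norm y_def .
qed

section \<open>Divisibility and parity\<close>

text \<open>
  For a fixed \<open>i\<close>, at least half of all subsets of \<open>K\<close> have a sum that is not divisible by \<open>d\<close>, so
  the average over the subsets already reaches half of \<open>I\<close>. The bound does not depend on the size of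
  \<open>K\<close>; this matters because \<open>K\<close> will be a set of coordinates, of unbounded size.
\<close>

lemma subset_sum_nonzero_half:
  fixes a :: "'k \<Rightarrow> 'i \<Rightarrow> int"
  assumes K: "finite K" and I: "finite I" and nz: "\<And>i. i \<in> I \<Longrightarrow> \<exists>k\<in>K. \<not> d dvd a k i"
  shows "\<exists>c\<subseteq>K. card I \<le> 2 * card {i \<in> I. \<not> d dvd (\<Sum>k\<in>c. a k i)}"
proof (rule ccontr)
  let ?s = "\<lambda>c i. \<Sum>k\<in>c. a k i"
  assume "\<not> ?thesis"
  then have less: "2 * card {i \<in> I. \<not> d dvd ?s c i} < card I" if "c \<in> Pow K" for c
    using that by (auto simp: not_le)
  have half: "card (Pow K) \<le> 2 * card {c \<in> Pow K. \<not> d dvd ?s c i}" if i: "i \<in> I" for i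
  proof -
    obtain k where k: "k \<in> K" "\<not> d dvd a k i" using nz[OF i] by blast
    \<comment> \<open>Toggling membership of \<open>k\<close> changes the sum by a nonmultiple of \<open>d\<close>, so it sends the
      vanishing subsets to nonvanishing ones.\<close>
    define flip where "flip c = (if k \<in> c then c - {k} else insert k c)" for c
    have flip_flip: "flip (flip c) = c" for c by (auto simp: flip_def)
    have "flip ` {c \<in> Pow K. d dvd ?s c i} \<subseteq> {c \<in> Pow K. \<not> d dvd ?s c i}"
    proof (rule image_subsetI)
      fix c assume "c \<in> {c \<in> Pow K. d dvd ?s c i}"
      then have c: "c \<in> Pow K" "d dvd ?s c i" by auto
      then have "finite c" using K finite_subset by auto
      then have "?s c i = a k i + ?s (flip c) i \<or> ?s (flip c) i = a k i + ?s c i"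
        by (auto simp: flip_def sum.remove)
      then have "\<not> d dvd ?s (flip c) i"
        using c(2) k(2) dvd_add_left_iff by (metis dvd_add_right_iff)
      moreover have "flip c \<in> Pow K" using c k by (auto simp: flip_def)
      ultimately show "flip c \<in> {c \<in> Pow K. \<not> d dvd ?s c i}" by blast
    qed
    moreover have "inj flip" by (metis flip_flip injI)
    ultimately have "card {c \<in> Pow K. d dvd ?s c i} \<le> card {c \<in> Pow K. \<not> d dvd ?s c i}"
      using K by (intro card_inj_on_le[of flip]) (auto intro: inj_on_subset)
    moreover have "card (Pow K) = card {c \<in> Pow K. d dvd ?s c i} + card {c \<in> Pow K. \<not> d dvd ?s c i}"
      using K by (subst card_Un_disjoint[symmetric]) (auto intro: arg_cong[where f = card])
    ultimately show ?thesis by linarith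
  qed
  have "card I * card (Pow K) \<le> (\<Sum>i\<in>I. 2 * card {c \<in> Pow K. \<not> d dvd ?s c i})"
    using sum_mono[of I "\<lambda>_. card (Pow K)"] half by simp
  also have "\<dots> = 2 * (\<Sum>i\<in>I. \<Sum>c\<in>Pow K. if \<not> d dvd ?s c i then 1 else 0)"
    using K by (simp add: sum_distrib_left[symmetric] sum.If_cases Int_def conj_commute)
  also have "\<dots> = 2 * (\<Sum>c\<in>Pow K. \<Sum>i\<in>I. if \<not> d dvd ?s c i then 1 else 0)"
    by (subst sum.swap) simp
  also have "\<dots> = (\<Sum>c\<in>Pow K. 2 * card {i \<in> I. \<not> d dvd ?s c i})"
    using I by (simp add: sum_distrib_left[symmetric] sum.If_cases Int_def conj_commute)
  also have "\<dots> < (\<Sum>c\<in>Pow K. card I)"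
    using K less by (intro sum_strict_mono) auto
  finally show False by simp
qed

lemma small_residue:
  fixes a d :: int
  assumes "d > 0"
  obtains u where "2 * d dvd a - u" "- d \<le> u" "u < d"
proof
  let ?u = "(a + d) mod (2 * d) - d"
  have "a - ?u = (a + d) - (a + d) mod (2 * d)" by simp
  also have "2 * d dvd \<dots>" by simp
  finally show "2 * d dvd a - ?u" .
  show "- d \<le> ?u" "?u < d"
    using assms pos_mod_sign[of "2 * d" "a + d"] pos_mod_bound[of "2 * d" "a + d"] by simp_all
qed

lemma symmetric_sum_parity:
  fixes f :: "nat \<Rightarrow> nat \<Rightarrow> int"
  assumes "\<And>i j. f i j = f j i"
  shows "2 dvd (\<Sum>i<n. \<Sum>j<n. f i j) - (\<Sum>i<n. f i i)"
proof (induction n)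
  case 0
  show ?case by simp
next
  case (Suc n)
  have sym: "(\<Sum>i<n. f n i) = (\<Sum>i<n. f i n)" by (rule sum.cong) (auto intro: assms)
  have "(\<Sum>i<Suc n. \<Sum>j<Suc n. f i j) - (\<Sum>i<Suc n. f i i)
      = ((\<Sum>i<n. \<Sum>j<n. f i j) - (\<Sum>i<n. f i i)) + 2 * (\<Sum>i<n. f i n)"
    by (simp add: sum.distrib sym)
  with Suc show ?case by (simp only: dvd_add dvd_triv_left)
qed

text \<open>
  Modulo 2 the off-diagonal terms of a symmetric form cancel in pairs and \<open>z\<^sub>i\<^sup>2\<close> may be replaced by \<open>z\<^sub>i\<close>:
  the diagonal of the Gram matrix is a characteristic covector.
\<close>

lemma form_diagonal_parity:
  assumes G: "G \<in> carrier_mat n n" and sym: "transpose_mat G = G" and z: "z \<in> carrier_vec n"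
  shows "2 dvd form G z z - (\<Sum>i<n. G $$ (i, i) * z $ i :: int)"
proof -
  have Gsym: "G $$ (i, j) = G $$ (j, i)" if "i < n" "j < n" for i j
    using G that index_transpose_mat(1)[of i G j] unfolding sym by auto
  let ?f = "\<lambda>i j. if i < n \<and> j < n then z $ i * G $$ (i, j) * z $ j else 0"
  have "form G z z = (\<Sum>i<n. \<Sum>j<n. ?f i j)"
    using z by (simp add: form_eq_sum[OF G])
  moreover have "2 dvd (\<Sum>i<n. \<Sum>j<n. ?f i j) - (\<Sum>i<n. ?f i i)"
    by (rule symmetric_sum_parity) (auto simp: Gsym)
  moreover have "2 dvd (\<Sum>i<n. ?f i i) - (\<Sum>i<n. G $$ (i, i) * z $ i)"
  proof -
    have "2 dvd z $ i * G $$ (i, i) * z $ i - G $$ (i, i) * z $ i" for i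
    proof -
      have "z $ i * G $$ (i, i) * z $ i - G $$ (i, i) * z $ i = G $$ (i, i) * (z $ i * (z $ i - 1))"
        by (simp add: algebra_simps)
      then show ?thesis by simp
    qed
    then have "2 dvd (\<Sum>i<n. z $ i * G $$ (i, i) * z $ i - G $$ (i, i) * z $ i)"
      by (intro dvd_sum) blast
    then show ?thesis by (simp add: sum_subtractf)
  qed
  ultimately show ?thesis using dvd_add by fastforce
qed

lemma quadratic_form_abs_bound:
  fixes A :: "int mat"
  assumes A: "A \<in> carrier_mat n n" and u: "u \<in> carrier_vec n"
    and le: "\<And>i. i < n \<Longrightarrow> \<bar>u $ i\<bar> \<le> d"
  shows "\<bar>u \<bullet> (A *\<^sub>v u)\<bar> \<le> d\<^sup>2 * (\<Sum>i<n. \<Sum>j<n. \<bar>A $$ (i, j)\<bar>)"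
proof -
  have "\<bar>u \<bullet> (A *\<^sub>v u)\<bar> = \<bar>\<Sum>i<n. \<Sum>j<n. u $ i * A $$ (i, j) * u $ j\<bar>"
    using form_eq_sum[OF A u u] by (simp add: form_def)
  also have "\<dots> \<le> (\<Sum>i<n. \<bar>\<Sum>j<n. u $ i * A $$ (i, j) * u $ j\<bar>)" by (rule sum_abs)
  also have "\<dots> \<le> (\<Sum>i<n. \<Sum>j<n. \<bar>u $ i * A $$ (i, j) * u $ j\<bar>)"
    by (intro sum_mono sum_abs)
  also have "\<dots> \<le> (\<Sum>i<n. \<Sum>j<n. d\<^sup>2 * \<bar>A $$ (i, j)\<bar>)"
  proof (intro sum_mono)
    fix i j assume "i \<in> {..<n}" "j \<in> {..<n}"
    then have "\<bar>u $ i\<bar> * \<bar>u $ j\<bar> \<le> d * d"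
      using le by (intro mult_mono) (auto intro: order_trans[OF abs_ge_zero])
    then have "\<bar>u $ i\<bar> * \<bar>u $ j\<bar> * \<bar>A $$ (i, j)\<bar> \<le> d * d * \<bar>A $$ (i, j)\<bar>"
      by (rule mult_right_mono) simp
    then show "\<bar>u $ i * A $$ (i, j) * u $ j\<bar> \<le> d\<^sup>2 * \<bar>A $$ (i, j)\<bar>"
      by (simp add: abs_mult power2_eq_square ac_simps)
  qed
  finally show ?thesis by (simp add: sum_distrib_left)
qed

section \<open>Embeddings of full rank\<close>

text \<open>
  \<open>P\<close> is the matrix of a homomorphism from \<open>G1 \<oplus> L\<close> to \<open>G2 \<oplus> \<langle>-1\<rangle>\<^sup>N\<close>; preservation of the forms is
  expressed by pulling back the Gram matrix.
\<close>

locale full_rank_embedding =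
  fixes G1 G2 L P :: "int mat" and N :: nat
  assumes G1: "neg_def_lattice G1" and G2: "neg_def_lattice G2" and L: "neg_def_lattice L"
    and rank: "rk G2 + N = rk G1 + rk L"
    and P: "P \<in> carrier_mat (rk G2 + N) (rk G2 + N)"
    and gram: "transpose_mat P * ((G2 \<oplus>\<^sub>L neg_one_pow N) * P) = G1 \<oplus>\<^sub>L L"
begin

abbreviation "r \<equiv> rk G2"
abbreviation "m \<equiv> rk G2 + N"
abbreviation "T \<equiv> G2 \<oplus>\<^sub>L neg_one_pow N"
abbreviation "S \<equiv> G1 \<oplus>\<^sub>L L"
abbreviation "d \<equiv> \<bar>det G1 * det L\<bar>"
abbreviation "incl v \<equiv> 0\<^sub>v (rk G1) @\<^sub>v v"

definition image_S :: "int vec set" where "image_S = (\<lambda>x. P *\<^sub>v x) ` carrier_vec m"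

definition image_L :: "int vec set" where "image_L = (\<lambda>v. P *\<^sub>v incl v) ` lattice_group L"

lemma shows nd_T: "neg_def_lattice T" and nd_S: "neg_def_lattice S"
  by (intro neg_def_lattice_sum neg_def_lattice_neg_one_pow G1 G2 L)+

lemma rk_T: "rk T = m"
  by simp

lemma T: "T \<in> carrier_mat m m"
  using neg_def_lattice_carrier[OF nd_T] by simp

lemma S: "S \<in> carrier_mat m m"
  using neg_def_lattice_carrier[OF nd_S] by (simp add: rank)

lemma P_vec: "x \<in> carrier_vec m \<Longrightarrow> P *\<^sub>v x \<in> carrier_vec m"
  using P by (rule mult_mat_vec_carrier)

lemma incl: "v \<in> lattice_group L \<Longrightarrow> incl v \<in> carrier_vec m"
  by (simp add: rank)

lemma d_pos: "d > 0"
  using neg_def_lattice_det_nonzero[OF G1] neg_def_lattice_det_nonzero[OF L] by simp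

lemma isometry:
  "x \<in> carrier_vec m \<Longrightarrow> y \<in> carrier_vec m \<Longrightarrow> form T (P *\<^sub>v x) (P *\<^sub>v y) = form S x y"
  by (simp only: form_congruence[OF T P] gram)

text \<open>
  Taking determinants in the Gram equation gives \<open>det P\<^sup>2 \<cdot> det T = det G1 \<cdot> det L\<close>, so \<open>det P\<close> divides
  \<open>d\<close> and a multiple of the adjugate of \<open>P\<close> is \<open>d P\<inverse>\<close>. Its rows are the functionals that detect \<open>image_S\<close>.
\<close>

lemma inverse_up_to_d:
  obtains Q where "Q \<in> carrier_mat m m" "P * Q = d \<cdot>\<^sub>m 1\<^sub>m m" "Q * P = d \<cdot>\<^sub>m 1\<^sub>m m"
proof -
  have "det G1 * det L = det (transpose_mat P * (T * P))"
    by (simp add: gram det_lattice_sum[OF G1 L])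
  also have "\<dots> = det P * (det P * det T)"
    using P T by (simp add: det_mult[of _ m] det_transpose[OF P])
  finally have det: "det G1 * det L = det P * (det P * det T)" .
  define k where "k = sgn (det G1 * det L) * (det P * det T)"
  have k: "k * det P = d"
    unfolding k_def by (simp only: det abs_sgn) (simp only: ac_simps)
  note adj = adj_mat[OF P]
  have scalar: "k \<cdot>\<^sub>m (det P \<cdot>\<^sub>m 1\<^sub>m m) = d \<cdot>\<^sub>m 1\<^sub>m m"
    by (intro eq_matI) (auto simp: k simp flip: mult.assoc)
  show thesis
  proof
    show "k \<cdot>\<^sub>m adj_mat P \<in> carrier_mat m m" using adj by simp
    show "P * (k \<cdot>\<^sub>m adj_mat P) = d \<cdot>\<^sub>m 1\<^sub>m m"
      by (simp only: mult_smult_distrib[OF P adj(1)] adj(2) scalar)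
    show "(k \<cdot>\<^sub>m adj_mat P) * P = d \<cdot>\<^sub>m 1\<^sub>m m"
      by (simp only: mult_smult_assoc_mat[OF adj(1) P] adj(3) scalar)
  qed
qed

lemma form_target:
  assumes "x \<in> carrier_vec m" "y \<in> carrier_vec m"
  shows "form T x y = form G2 (vec_first x r) (vec_first y r) - (\<Sum>i=r..<m. x $ i * y $ i)"
proof -
  have "form T x y = form T (vec_first x r @\<^sub>v vec_last x N) (vec_first y r @\<^sub>v vec_last y N)"
    using assms by simp
  also have "\<dots> = form G2 (vec_first x r) (vec_first y r) - vec_last x N \<bullet> vec_last y N"
    using neg_def_lattice_carrier[OF G2]
    by (subst form_append) (auto simp: form_neg_one_pow)
  also have "vec_last x N \<bullet> vec_last y N = (\<Sum>i<N. x $ (r + i) * y $ (r + i))"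
    using assms by (auto simp: scalar_prod_def vec_last_def lessThan_atLeast0 intro!: sum.cong)
  also have "\<dots> = (\<Sum>i=r..<m. x $ i * y $ i)"
    using sum.shift_bounds_nat_ivl[of "\<lambda>i. x $ i * y $ i" 0 r N]
    by (simp add: lessThan_atLeast0 add.commute)
  finally show ?thesis .
qed

lemma T_index: "r \<le> i \<Longrightarrow> i < m \<Longrightarrow> j < m \<Longrightarrow> T $$ (i, j) = (if i = j then -1 else 0)"
  using carrier_matD[OF neg_def_lattice_carrier[OF G2]] carrier_matD[OF neg_one_pow_carrier[of N]]
  by (auto simp: lattice_sum_def neg_one_pow_index)

lemma form_unit_target:
  assumes "r \<le> i" "i < m" "y \<in> carrier_vec m"
  shows "form T (unit_vec m i) y = - (y $ i)"
proof -
  have "form T (unit_vec m i) y = (\<Sum>j<m. T $$ (i, j) * y $ j)"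
    using assms T by (simp add: form_unit_left[OF T] scalar_prod_def lessThan_atLeast0)
  also have "\<dots> = (\<Sum>j<m. if j = i then - (y $ j) else 0)"
    using assms by (intro sum.cong) (auto simp: T_index)
  finally show ?thesis using assms by simp
qed

lemma form_incl:
  assumes "v \<in> lattice_group L" "v' \<in> lattice_group L"
  shows "form T (P *\<^sub>v incl v) (P *\<^sub>v incl v') = form L v v'"
proof -
  have "form T (P *\<^sub>v incl v) (P *\<^sub>v incl v') = form S (incl v) (incl v')"
    using incl assms by (intro isometry)
  also have "\<dots> = form L v v'"
    using neg_def_lattice_carrier[OF G1] neg_def_lattice_carrier[OF L] assms
    by (subst form_append) (auto simp: form_def)
  finally show ?thesis .
qed

lemma mem_image_S_iff:
  assumes Q: "Q \<in> carrier_mat m m" "P * Q = d \<cdot>\<^sub>m 1\<^sub>m m" "Q * P = d \<cdot>\<^sub>m 1\<^sub>m m"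
    and z: "z \<in> carrier_vec m"
  shows "z \<in> image_S \<longleftrightarrow> (\<forall>k<m. d dvd (Q *\<^sub>v z) $ k)"
proof
  assume "z \<in> image_S"
  then obtain x where x: "x \<in> carrier_vec m" "z = P *\<^sub>v x" by (auto simp: image_S_def)
  have "Q *\<^sub>v z = (Q * P) *\<^sub>v x" using assoc_mult_mat_vec[OF Q(1) P x(1)] x(2) by simp
  also have "\<dots> = d \<cdot>\<^sub>v x" using x by (simp only: Q(3) scalar_one_mat_mult_vec)
  finally show "\<forall>k<m. d dvd (Q *\<^sub>v z) $ k" using x by auto
next
  assume dvd: "\<forall>k<m. d dvd (Q *\<^sub>v z) $ k"
  define y where "y = vec m (\<lambda>k. (Q *\<^sub>v z) $ k div d)"
  have y: "y \<in> carrier_vec m" by (simp add: y_def)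
  have "Q *\<^sub>v z = d \<cdot>\<^sub>v y" using dvd Q by (intro eq_vecI) (auto simp: y_def)
  then have "(P * Q) *\<^sub>v z = P *\<^sub>v (d \<cdot>\<^sub>v y)" using assoc_mult_mat_vec[OF P Q(1) z] by simp
  then have "d \<cdot>\<^sub>v z = d \<cdot>\<^sub>v (P *\<^sub>v y)"
    using z y P by (simp only: Q(2) scalar_one_mat_mult_vec) (simp add: mult_mat_vec_smult)
  moreover have "d \<noteq> 0" using d_pos by linarith
  ultimately have "z = P *\<^sub>v y" using z P_vec[OF y] by (rule smult_cancel_vec)
  then show "z \<in> image_S" using y by (auto simp: image_S_def)
qed

section \<open>Few coordinate vectors outside the image\<close>

text \<open>
  Covectors are integer vectors paired by the dot product; this is the pullback of a covector of the
  target along the embedding of \<open>L\<close>.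
\<close>

definition restrict_L :: "int vec \<Rightarrow> int vec" where
  "restrict_L u = vec_last (transpose_mat P *\<^sub>v u) (rk L)"

lemma restrict_L_carrier: "restrict_L u \<in> lattice_group L"
  by (simp add: restrict_L_def)

lemma restrict_L_pairing:
  assumes u: "u \<in> carrier_vec m" and v: "v \<in> lattice_group L"
  shows "restrict_L u \<bullet> v = u \<bullet> (P *\<^sub>v incl v)"
proof -
  have PTu: "transpose_mat P *\<^sub>v u \<in> carrier_vec (rk G1 + rk L)"
    using mult_mat_vec_carrier[of "transpose_mat P" m m u] P u by (simp add: rank)
  have "u \<bullet> (P *\<^sub>v incl v) = (transpose_mat P *\<^sub>v u) \<bullet> incl v"
    using transpose_vec_mult_scalar[OF P incl[OF v] u] by simp
  also have "\<dots> = (vec_first (transpose_mat P *\<^sub>v u) (rk G1) @\<^sub>v restrict_L u) \<bullet> incl v"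
    using PTu by (simp add: restrict_L_def)
  also have "\<dots> = restrict_L u \<bullet> v"
    using v restrict_L_carrier by (subst scalar_prod_append[of _ "rk G1" _ "rk L"]) auto
  finally show ?thesis by simp
qed

text \<open>
  With \<open>x = X / g\<close> dual to \<open>u\<close>, and \<open>Y\<close> the image in the target of the vector of \<open>L \<otimes> \<rat>\<close> dual to
  \<open>restrict_L u\<close>, the vector \<open>x - Y\<close> is orthogonal to \<open>Y\<close>. As the form is negative definite, the norm of
  \<open>Y\<close> does not exceed that of \<open>x\<close>. Denominators are cleared because definiteness is known for integer
  vectors only.
\<close>

lemma projection_bound:
  fixes u X
  defines "w \<equiv> restrict_L u" and "y \<equiv> adj_mat L *\<^sub>v restrict_L u"
  assumes u: "u \<in> carrier_vec m" and X: "X \<in> carrier_vec m" and TX: "T *\<^sub>v X = g \<cdot>\<^sub>v u" and "g \<noteq> 0"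
  shows "\<bar>real_of_int (w \<bullet> y) / real_of_int (det L)\<bar> \<le> - (real_of_int (u \<bullet> X) / real_of_int g)"
proof -
  let ?D = "det L"
  note Lc = neg_def_lattice_carrier[OF L]
  have D: "?D \<noteq> 0" by (rule neg_def_lattice_det_nonzero[OF L])
  have w: "w \<in> lattice_group L" unfolding w_def by (rule restrict_L_carrier)
  note adj = adj_mat[OF Lc]
  have y: "y \<in> lattice_group L"
    unfolding y_def using mult_mat_vec_carrier[OF adj(1) restrict_L_carrier] .
  have Ly: "L *\<^sub>v y = ?D \<cdot>\<^sub>v w"
  proof -
    have "L *\<^sub>v y = (L * adj_mat L) *\<^sub>v w"
      unfolding y_def w_def[symmetric] using assoc_mult_mat_vec[OF Lc adj(1) w] by simp
    then show ?thesis by (simp only: adj(2) scalar_one_mat_mult_vec[OF w])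
  qed
  define Y where "Y = P *\<^sub>v incl y"
  have Y: "Y \<in> carrier_vec m" unfolding Y_def by (intro P_vec incl y)
  have wy: "w \<bullet> y = u \<bullet> Y" unfolding w_def Y_def by (rule restrict_L_pairing[OF u y])
  have YY: "form T Y Y = ?D * (w \<bullet> y)"
    unfolding Y_def form_incl[OF y y] using w y by (simp add: form_def Ly comm_scalar_prod[OF y w])
  have XX: "form T X X = g * (u \<bullet> X)"
    using u X by (simp add: form_def TX comm_scalar_prod[OF X u])
  have YX: "form T Y X = g * (w \<bullet> y)"
    using u Y by (simp add: form_def TX wy comm_scalar_prod[OF Y u])
  have XY: "form T X Y = g * (w \<bullet> y)"
    using neg_def_lattice_form_commute[OF nd_T, of X Y] X Y YX by simp
  have "form T (?D \<cdot>\<^sub>v X - g \<cdot>\<^sub>v Y) (?D \<cdot>\<^sub>v X - g \<cdot>\<^sub>v Y)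
      = ?D\<^sup>2 * g * (u \<bullet> X) - ?D * g\<^sup>2 * (w \<bullet> y)"
    using X Y by (simp add: form_minus_left[OF T] form_minus_right[OF T] form_smult_left[OF T]
        form_smult_right[OF T] XX XY YX YY power2_eq_square algebra_simps)
  then have "?D\<^sup>2 * g * (u \<bullet> X) \<le> ?D * g\<^sup>2 * (w \<bullet> y)"
    using neg_def_lattice_nonpos[OF nd_T, of "?D \<cdot>\<^sub>v X - g \<cdot>\<^sub>v Y"] X Y by simp
  then have "real_of_int (?D\<^sup>2 * g * (u \<bullet> X)) \<le> real_of_int (?D * g\<^sup>2 * (w \<bullet> y))"
    by (simp only: of_int_le_iff)
  moreover have "real_of_int (?D\<^sup>2 * g * (u \<bullet> X))
      = (real_of_int ?D)\<^sup>2 * (real_of_int g)\<^sup>2 * (real_of_int (u \<bullet> X) / real_of_int g)"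
    using \<open>g \<noteq> 0\<close> by (simp add: power2_eq_square)
  moreover have "real_of_int (?D * g\<^sup>2 * (w \<bullet> y))
      = (real_of_int ?D)\<^sup>2 * (real_of_int g)\<^sup>2 * (real_of_int (w \<bullet> y) / real_of_int ?D)"
    using D by (simp add: power2_eq_square)
  ultimately have "(real_of_int ?D)\<^sup>2 * (real_of_int g)\<^sup>2 * (real_of_int (u \<bullet> X) / real_of_int g)
      \<le> (real_of_int ?D)\<^sup>2 * (real_of_int g)\<^sup>2 * (real_of_int (w \<bullet> y) / real_of_int ?D)"
    by (simp only:)
  moreover have "0 < (real_of_int ?D)\<^sup>2 * (real_of_int g)\<^sup>2" using \<open>g \<noteq> 0\<close> D by simp
  ultimately have "real_of_int (u \<bullet> X) / real_of_int g \<le> real_of_int (w \<bullet> y) / real_of_int ?D"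
    by (simp only: mult_le_cancel_left_pos)
  moreover have "real_of_int (w \<bullet> y) / real_of_int ?D \<le> 0"
  proof -
    have "?D * (w \<bullet> y) \<le> 0" using neg_def_lattice_nonpos[OF nd_T Y[folded rk_T]] YY by simp
    then show ?thesis by (auto simp: divide_le_0_iff mult_le_0_iff)
  qed
  ultimately show ?thesis by linarith
qed

text \<open>
  An explicit dual vector of \<open>u\<close>, scaled by \<open>det G2\<close>. Inverting only the block \<open>G2\<close> keeps the constants
  that it contributes independent of \<open>N\<close>.
\<close>

lemma target_dual_vector:
  assumes u: "u \<in> carrier_vec m"
  defines "X \<equiv> (adj_mat G2 *\<^sub>v vec_first u r) @\<^sub>v (- det G2 \<cdot>\<^sub>v vec_last u N)"
  shows "X \<in> carrier_vec m" "T *\<^sub>v X = det G2 \<cdot>\<^sub>v u"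
    "u \<bullet> X = vec_first u r \<bullet> (adj_mat G2 *\<^sub>v vec_first u r) - det G2 * (\<Sum>i=r..<m. (u $ i)\<^sup>2)"
proof -
  note Gc = neg_def_lattice_carrier[OF G2]
  note adj = adj_mat[OF Gc]
  let ?a = "vec_first u r" and ?b = "vec_last u N"
  have ya: "adj_mat G2 *\<^sub>v ?a \<in> carrier_vec r" by (rule mult_mat_vec_carrier[OF adj(1)]) simp
  then show "X \<in> carrier_vec m" unfolding X_def by auto
  have "G2 *\<^sub>v (adj_mat G2 *\<^sub>v ?a) = (G2 * adj_mat G2) *\<^sub>v ?a"
    using assoc_mult_mat_vec[OF Gc adj(1), of ?a] by simp
  also have "\<dots> = det G2 \<cdot>\<^sub>v ?a" by (simp add: adj(2) scalar_one_mat_mult_vec)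
  finally have top: "G2 *\<^sub>v (adj_mat G2 *\<^sub>v ?a) = det G2 \<cdot>\<^sub>v ?a" .
  have "neg_one_pow N = - 1 \<cdot>\<^sub>m 1\<^sub>m N" by (intro eq_matI) (auto simp: neg_one_pow_eq)
  then have bot: "neg_one_pow N *\<^sub>v (- det G2 \<cdot>\<^sub>v ?b) = det G2 \<cdot>\<^sub>v ?b"
    by (simp only: scalar_one_mat_mult_vec[of _ N] smult_carrier_vec vec_last_carrier
        smult_smult_assoc) simp
  have "T *\<^sub>v X = G2 *\<^sub>v (adj_mat G2 *\<^sub>v ?a) @\<^sub>v neg_one_pow N *\<^sub>v (- det G2 \<cdot>\<^sub>v ?b)"
    unfolding X_def lattice_sum_def rk_neg_one_pow
    by (rule mult_mat_vec_split[OF Gc neg_one_pow_carrier ya]) simp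
  also have "\<dots> = det G2 \<cdot>\<^sub>v (?a @\<^sub>v ?b)" unfolding top bot by (auto simp: vec_eq_iff)
  finally show "T *\<^sub>v X = det G2 \<cdot>\<^sub>v u" using u by simp
  have "u \<bullet> X = (?a @\<^sub>v ?b) \<bullet> X" using u by simp
  also have "\<dots> = ?a \<bullet> (adj_mat G2 *\<^sub>v ?a) + ?b \<bullet> (- det G2 \<cdot>\<^sub>v ?b)"
    unfolding X_def by (rule scalar_prod_append[of _ r _ N]) (use ya in auto)
  also have "?b \<bullet> (- det G2 \<cdot>\<^sub>v ?b) = - det G2 * (\<Sum>i<N. (u $ (r + i))\<^sup>2)"
    using u by (auto simp: scalar_prod_def vec_last_def lessThan_atLeast0 power2_eq_square
        sum_distrib_left intro!: sum.cong)
  also have "(\<Sum>i<N. (u $ (r + i))\<^sup>2) = (\<Sum>i=r..<m. (u $ i)\<^sup>2)"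
    using sum.shift_bounds_nat_ivl[of "\<lambda>i. (u $ i)\<^sup>2" 0 r N]
    by (simp add: lessThan_atLeast0 add.commute)
  finally show "u \<bullet> X = vec_first u r \<bullet> (adj_mat G2 *\<^sub>v vec_first u r)
      - det G2 * (\<Sum>i=r..<m. (u $ i)\<^sup>2)" by simp
qed

lemma covector_norm_bound:
  assumes u: "u \<in> carrier_vec m" and le: "\<And>i. i < m \<Longrightarrow> \<bar>u $ i\<bar> \<le> c"
  shows "\<bar>real_of_int (restrict_L u \<bullet> (adj_mat L *\<^sub>v restrict_L u)) / real_of_int (det L)\<bar>
    \<le> real_of_int (c\<^sup>2 * (\<Sum>i<r. \<Sum>j<r. \<bar>adj_mat G2 $$ (i, j)\<bar>) + (\<Sum>i=r..<m. (u $ i)\<^sup>2))"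
proof -
  let ?K = "\<Sum>i<r. \<Sum>j<r. \<bar>adj_mat G2 $$ (i, j)\<bar>" and ?a = "vec_first u r"
  let ?q = "?a \<bullet> (adj_mat G2 *\<^sub>v ?a)" and ?g = "det G2"
  note adj = adj_mat[OF neg_def_lattice_carrier[OF G2]]
  have g: "?g \<noteq> 0" by (rule neg_def_lattice_det_nonzero[OF G2])
  have "\<bar>?q\<bar> \<le> c\<^sup>2 * ?K"
    by (rule quadratic_form_abs_bound[OF adj(1)]) (use u le in \<open>auto simp: vec_first_def\<close>)
  then have q: "\<bar>real_of_int ?q\<bar> \<le> real_of_int (c\<^sup>2 * ?K)"
    by (metis of_int_abs of_int_le_iff)
  have "\<bar>real_of_int ?q / real_of_int ?g\<bar> \<le> \<bar>real_of_int ?q\<bar>"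
  proof -
    have "1 \<le> \<bar>real_of_int ?g\<bar>" using g by linarith
    then show ?thesis
      using divide_left_mono[of 1 "\<bar>real_of_int ?g\<bar>" "\<bar>real_of_int ?q\<bar>"] by simp
  qed
  note projection_bound[OF u target_dual_vector(1,2)[OF u] g]
  also have "- (real_of_int (u \<bullet> (adj_mat G2 *\<^sub>v ?a @\<^sub>v - ?g \<cdot>\<^sub>v vec_last u N)) / real_of_int ?g)
      = - (real_of_int ?q / real_of_int ?g) + real_of_int (\<Sum>i=r..<m. (u $ i)\<^sup>2)"
    unfolding target_dual_vector(3)[OF u] using g by (simp add: field_simps)
  also have "\<dots> \<le> real_of_int (c\<^sup>2 * ?K) + real_of_int (\<Sum>i=r..<m. (u $ i)\<^sup>2)"
    using q \<open>\<bar>real_of_int ?q / real_of_int ?g\<bar> \<le> \<bar>real_of_int ?q\<bar>\<close> by linarith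
  finally show ?thesis by simp
qed

text \<open>
  The covector \<open>u / d\<close> built here is \<open>p + 2 q / d\<close> reduced by even integers, where \<open>p\<close> is the diagonal of
  the Gram matrix. Its norm on the part \<open>\<langle>-1\<rangle>\<^sup>N\<close> falls short of \<open>N\<close> by at least \<open>1/d\<close> for each coordinate
  that is not an odd integer, and \<open>delta L\<close> limits this gain.
\<close>

lemma missing_units_image_S_bound:
  "real (card {i \<in> {r..<m}. unit_vec m i \<notin> image_S}) \<le>
    2 * real_of_int d *
      (real_of_int (\<Sum>i<r. \<Sum>j<r. \<bar>adj_mat G2 $$ (i, j)\<bar>) + real (rk G1) + 4 * delta L)"
proof -
  let ?I = "{i \<in> {r..<m}. unit_vec m i \<notin> image_S}"
  let ?K = "\<Sum>i<r. \<Sum>j<r. \<bar>adj_mat G2 $$ (i, j)\<bar>"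
  obtain Q where Q: "Q \<in> carrier_mat m m" "P * Q = d \<cdot>\<^sub>m 1\<^sub>m m" "Q * P = d \<cdot>\<^sub>m 1\<^sub>m m"
    by (rule inverse_up_to_d)
  have "\<exists>k\<in>{..<m}. \<not> d dvd Q $$ (k, i)" if "i \<in> ?I" for i
  proof -
    have "\<exists>k<m. \<not> d dvd (Q *\<^sub>v unit_vec m i) $ k"
      using that mem_image_S_iff[OF Q, of "unit_vec m i"] by auto
    moreover have "(Q *\<^sub>v unit_vec m i) $ k = Q $$ (k, i)" if "k < m" for k
      using that Q \<open>i \<in> ?I\<close> by auto
    ultimately show ?thesis by auto
  qed
  then obtain c where c: "c \<subseteq> {..<m}"
    "card ?I \<le> 2 * card {i \<in> ?I. \<not> d dvd (\<Sum>k\<in>c. Q $$ (k, i))}"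
    using subset_sum_nonzero_half[of "{..<m}" ?I d "\<lambda>k i. Q $$ (k, i)"] by auto
  \<comment> \<open>The functional \<open>q\<close> is a sum of rows of \<open>d P\<inverse>\<close>, so it takes multiples of \<open>d\<close> as values on \<open>image_S\<close>.\<close>
  define q where "q i = (\<Sum>k\<in>c. Q $$ (k, i))" for i
  let ?J = "{i \<in> ?I. \<not> d dvd q i}"
  have "\<exists>f. \<forall>i. 2 * d dvd (d * T $$ (i, i) + 2 * q i) - f i \<and> - d \<le> f i \<and> f i < d"
    by (intro choice allI) (metis small_residue[OF d_pos])
  then obtain f where f: "\<And>i. 2 * d dvd (d * T $$ (i, i) + 2 * q i) - f i"
    "\<And>i. - d \<le> f i" "\<And>i. f i < d" by blast
  define u where "u = vec m f"
  have u: "u \<in> carrier_vec m" by (simp add: u_def)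
  have char: "2 * d dvd restrict_L u \<bullet> v - d * form L v v" if v: "v \<in> lattice_group L" for v
  proof -
    define z where "z = P *\<^sub>v incl v"
    have z: "z \<in> carrier_vec m" "z \<in> image_S"
      using P_vec incl[OF v] by (auto simp: z_def image_S_def)
    have "(\<Sum>i<m. q i * z $ i) = (\<Sum>i<m. \<Sum>k\<in>c. Q $$ (k, i) * z $ i)"
      by (simp add: q_def sum_distrib_right)
    also have "\<dots> = (\<Sum>k\<in>c. \<Sum>i<m. Q $$ (k, i) * z $ i)" by (rule sum.swap)
    also have "\<dots> = (\<Sum>k\<in>c. (Q *\<^sub>v z) $ k)"
      using c(1) Q z by (intro sum.cong) (auto simp: scalar_prod_def lessThan_atLeast0)
    also have "d dvd \<dots>"
      using mem_image_S_iff[OF Q z(1)] z(2) c(1) by (intro dvd_sum) auto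
    finally have qz: "2 * d dvd 2 * (\<Sum>i<m. q i * z $ i)" by (rule mult_dvd_mono[OF dvd_refl])
    have fz: "2 * d dvd (\<Sum>i<m. ((d * T $$ (i, i) + 2 * q i) - f i) * z $ i)"
      using f(1) by (intro dvd_sum dvd_mult2)
    have Tz: "2 * d dvd d * (form T z z - (\<Sum>i<m. T $$ (i, i) * z $ i))"
      using form_diagonal_parity[OF T neg_def_lattice_transpose[OF nd_T] z(1)]
      by (subst mult.commute) (rule mult_dvd_mono[OF dvd_refl])
    have uz: "u \<bullet> z = (\<Sum>i<m. f i * z $ i)"
      using z by (simp add: scalar_prod_def u_def lessThan_atLeast0)
    have "restrict_L u \<bullet> v - d * form L v v = u \<bullet> z - d * form T z z"
      by (simp add: restrict_L_pairing[OF u v] z_def form_incl[OF v v])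
    also have "\<dots> = 2 * (\<Sum>i<m. q i * z $ i)
        - (\<Sum>i<m. ((d * T $$ (i, i) + 2 * q i) - f i) * z $ i)
        - d * (form T z z - (\<Sum>i<m. T $$ (i, i) * z $ i))"
      unfolding uz by (simp add: algebra_simps sum.distrib sum_subtractf sum_distrib_left)
    also have "2 * d dvd \<dots>" by (intro dvd_diff qz fz Tz)
    finally show ?thesis .
  qed
  have square: "(f i)\<^sup>2 \<le> d\<^sup>2" for i
    using f(2,3)[of i] by (simp add: abs_le_square_iff[symmetric])
  \<comment> \<open>At these coordinates \<open>T\<close> has the odd diagonal entry \<open>-1\<close>, so \<open>f i = - d\<close> would make \<open>d\<close> divide \<open>q i\<close>.\<close>
  have square_J: "(f i)\<^sup>2 \<le> d\<^sup>2 - d" if i: "i \<in> ?J" for i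
  proof -
    have "f i \<noteq> - d"
    proof
      assume "f i = - d"
      moreover have "T $$ (i, i) = -1" using i by (simp add: T_index)
      ultimately have "2 * d dvd 2 * q i" using f(1)[of i] by simp
      then show False using i by simp
    qed
    then have "\<bar>f i\<bar> \<le> d - 1" using f(2,3)[of i] by linarith
    then have "(f i)\<^sup>2 \<le> (d - 1)\<^sup>2" using d_pos by (intro power2_le_iff_abs_le[THEN iffD2]) auto
    also have "\<dots> = d\<^sup>2 - d - (d - 1)" by (simp only: power2_eq_square algebra_simps)
    also have "\<dots> \<le> d\<^sup>2 - d" using d_pos by linarith
    finally show ?thesis .
  qed
  have "(\<Sum>i=r..<m. (u $ i)\<^sup>2) = (\<Sum>i=r..<m. (f i)\<^sup>2)" by (simp add: u_def)
  also have "\<dots> \<le> (\<Sum>i=r..<m. d\<^sup>2 - (if i \<in> ?J then d else 0))"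
    using square square_J by (intro sum_mono) auto
  also have "\<dots> = int N * d\<^sup>2 - int (card ?J) * d"
  proof -
    have "(\<Sum>i=r..<m. if i \<in> ?J then d else 0) = (\<Sum>i\<in>?J. d)"
      by (rule sum.mono_neutral_cong_right) auto
    then show ?thesis by (simp add: sum_subtractf)
  qed
  finally have sum_squares: "(\<Sum>i=r..<m. (u $ i)\<^sup>2) \<le> int N * d\<^sup>2 - int (card ?J) * d" .
  let ?w = "restrict_L u"
  let ?A = "\<bar>real_of_int (?w \<bullet> (adj_mat L *\<^sub>v ?w)) / real_of_int (det L)\<bar>"
  have "\<bar>u $ i\<bar> \<le> d" if "i < m" for i
    unfolding u_def index_vec[OF that] using f(2,3)[of i] by linarith
  then have "?A \<le> real_of_int (d\<^sup>2 * ?K + (\<Sum>i=r..<m. (u $ i)\<^sup>2))"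
    by (rule covector_norm_bound[OF u])
  also have "\<dots> \<le> real_of_int (d\<^sup>2 * ?K + (int N * d\<^sup>2 - int (card ?J) * d))"
    using sum_squares by (simp only: of_int_le_iff)
  also have "\<dots> = (real_of_int d)\<^sup>2 * (real_of_int ?K + real N - real (card ?J) / real_of_int d)"
    using d_pos by (simp add: power2_eq_square field_simps)
  finally have A: "?A \<le> \<dots>" .
  have "real (rk L) - 4 * delta L \<le> ?A / (real_of_int d)\<^sup>2"
    using delta_integral_covector_bound[OF L restrict_L_carrier d_pos char]
    by (simp add: abs_divide abs_mult ac_simps)
  also have "\<dots> \<le> real_of_int ?K + real N - real (card ?J) / real_of_int d"
    using A d_pos by (simp add: divide_le_eq mult.commute)
  finally have "real (card ?J) / real_of_int d \<le> real_of_int ?K + real N - real (rk L) + 4 * delta L"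
    by linarith
  also have "\<dots> \<le> real_of_int ?K + real (rk G1) + 4 * delta L"
    using rank by linarith
  finally have "real (card ?J) \<le> real_of_int d * (real_of_int ?K + real (rk G1) + 4 * delta L)"
    using d_pos by (simp add: divide_le_eq mult.commute)
  moreover have "real (card ?I) \<le> 2 * real (card ?J)"
    using c(2) unfolding q_def by linarith
  ultimately show ?thesis by linarith
qed

section \<open>The orthogonal complement of the first summand\<close>

definition basis_G1 :: "nat \<Rightarrow> int vec" where
  "basis_G1 j = P *\<^sub>v (unit_vec (rk G1) j @\<^sub>v 0\<^sub>v (rk L))"

lemma basis_G1_carrier: "basis_G1 j \<in> carrier_vec m"
  unfolding basis_G1_def by (rule P_vec) (simp add: rank)

lemma form_basis_G1:
  assumes "j < rk G1" "a \<in> lattice_group G1" "b \<in> lattice_group L"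
  shows "form T (basis_G1 j) (P *\<^sub>v (a @\<^sub>v b)) = (G1 *\<^sub>v a) $ j"
proof -
  note c = neg_def_lattice_carrier[OF G1] neg_def_lattice_carrier[OF L]
  have "form T (basis_G1 j) (P *\<^sub>v (a @\<^sub>v b)) = form S (unit_vec (rk G1) j @\<^sub>v 0\<^sub>v (rk L)) (a @\<^sub>v b)"
    unfolding basis_G1_def by (rule isometry) (use assms rank in auto)
  also have "\<dots> = form G1 (unit_vec (rk G1) j) a + form L (0\<^sub>v (rk L)) b"
    by (rule form_append[OF c]) (use assms in auto)
  also have "form L (0\<^sub>v (rk L)) b = 0"
    using c(2) assms(3) mult_mat_vec_carrier[OF c(2) assms(3)] by (simp add: form_def)
  finally show ?thesis using assms by (simp add: form_unit_left[OF c(1)])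
qed

lemma form_basis_G1_self: "j < rk G1 \<Longrightarrow> form T (basis_G1 j) (basis_G1 j) = G1 $$ (j, j)"
  using form_basis_G1[of j "unit_vec (rk G1) j" "0\<^sub>v (rk L)"] neg_def_lattice_carrier[OF G1]
  by (simp add: basis_G1_def[symmetric])

text \<open>
  The summands are orthogonal and \<open>G1\<close> is nondegenerate, so inside the image of \<open>G1 \<oplus> L\<close> the image of
  \<open>L\<close> is exactly the orthogonal complement of the image of \<open>G1\<close>.
\<close>

lemma image_L_iff:
  assumes "z \<in> image_S"
  shows "z \<in> image_L \<longleftrightarrow> (\<forall>j<rk G1. form T (basis_G1 j) z = 0)"
proof
  note G1c = neg_def_lattice_carrier[OF G1]
  assume "z \<in> image_L"
  then obtain v where v: "v \<in> lattice_group L" "z = P *\<^sub>v incl v" by (auto simp: image_L_def)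
  have "form T (basis_G1 j) z = 0" if j: "j < rk G1" for j
    using form_basis_G1[OF j zero_carrier_vec v(1)] j G1c by (simp add: v(2))
  then show "\<forall>j<rk G1. form T (basis_G1 j) z = 0" by blast
next
  note G1c = neg_def_lattice_carrier[OF G1]
  assume orth: "\<forall>j<rk G1. form T (basis_G1 j) z = 0"
  obtain x where x: "x \<in> carrier_vec m" "z = P *\<^sub>v x" using assms by (auto simp: image_S_def)
  let ?a = "vec_first x (rk G1)" and ?b = "vec_last x (rk L)"
  have x_eq: "?a @\<^sub>v ?b = x" using x(1) by (simp add: rank)
  have "G1 *\<^sub>v ?a = 0\<^sub>v (rk G1)"
  proof (rule eq_vecI)
    fix j assume j: "j < dim_vec (0\<^sub>v (rk G1) :: int vec)"
    then show "(G1 *\<^sub>v ?a) $ j = 0\<^sub>v (rk G1) $ j"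
      using form_basis_G1[of j ?a ?b] orth x(2) x_eq by simp
  qed (use G1c in simp)
  then have "form G1 ?a ?a = 0" by (simp add: form_def)
  then have "?a = 0\<^sub>v (rk G1)" by (intro neg_def_lattice_form_eq_0[OF G1]) simp_all
  then have "z = P *\<^sub>v incl ?b" using x(2) x_eq by simp
  then show "z \<in> image_L" by (auto simp: image_L_def)
qed

lemma image_L_subset: "image_L \<subseteq> image_S"
  using incl by (auto simp: image_L_def image_S_def)

lemma image_S_carrier: "image_S \<subseteq> carrier_vec m"
  using P_vec by (auto simp: image_S_def)

lemma image_L_comb:
  assumes "x \<in> image_L" "y \<in> image_L"
  shows "x + c \<cdot>\<^sub>v y \<in> image_L"
proof -
  obtain v w where v: "v \<in> lattice_group L" "x = P *\<^sub>v incl v"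
    and w: "w \<in> lattice_group L" "y = P *\<^sub>v incl w"
    using assms by (auto simp: image_L_def)
  have "P *\<^sub>v (incl v + c \<cdot>\<^sub>v incl w) = x + c \<cdot>\<^sub>v y"
    using mult_add_distrib_mat_vec[OF P incl[OF v(1)], of "c \<cdot>\<^sub>v incl w"] incl[OF w(1)]
    by (simp add: v w mult_mat_vec_smult[OF P])
  moreover have "incl v + c \<cdot>\<^sub>v incl w = incl (v + c \<cdot>\<^sub>v w)"
    using v(1) w(1) by (auto simp: vec_eq_iff)
  ultimately have "x + c \<cdot>\<^sub>v y = P *\<^sub>v incl (v + c \<cdot>\<^sub>v w)" by simp
  moreover have "v + c \<cdot>\<^sub>v w \<in> lattice_group L" using v(1) w(1) by simp
  ultimately show ?thesis unfolding image_L_def by (rule image_eqI)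
qed

lemma image_S_congruent:
  assumes "z \<in> image_S" and z': "z' \<in> carrier_vec m" and cong: "\<And>i. i < m \<Longrightarrow> d dvd z' $ i - z $ i"
  shows "z' \<in> image_S"
proof -
  obtain Q where Q: "Q \<in> carrier_mat m m" "P * Q = d \<cdot>\<^sub>m 1\<^sub>m m" "Q * P = d \<cdot>\<^sub>m 1\<^sub>m m"
    by (rule inverse_up_to_d)
  have z: "z \<in> carrier_vec m" using assms(1) image_S_carrier by blast
  have "d dvd (Q *\<^sub>v z') $ k" if k: "k < m" for k
  proof -
    have "(Q *\<^sub>v z') $ k - (Q *\<^sub>v z) $ k = (\<Sum>i<m. Q $$ (k, i) * (z' $ i - z $ i))"
      using Q z z' k by (simp add: scalar_prod_def lessThan_atLeast0 right_diff_distrib sum_subtractf)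
    also have "d dvd \<dots>" by (intro dvd_sum dvd_mult cong) simp
    finally have "d dvd (Q *\<^sub>v z') $ k - (Q *\<^sub>v z) $ k" .
    moreover have "d dvd (Q *\<^sub>v z) $ k" using mem_image_S_iff[OF Q z] assms(1) k by blast
    ultimately show ?thesis using dvd_add by (metis diff_add_cancel)
  qed
  then show ?thesis using mem_image_S_iff[OF Q z'] by blast
qed

text \<open>
  The form is nonpositive at \<open>basis_G1 j + e\<close> and at \<open>basis_G1 j - e\<close>, which bounds the mixed term. This
  is enough in place of a Cauchy-Schwarz inequality.
\<close>

lemma form_basis_G1_unit_bound:
  assumes "j < rk G1" "i < m"
  shows "\<bar>form T (basis_G1 j) (unit_vec m i)\<bar> \<le> \<bar>G1 $$ (j, j)\<bar> + \<bar>T $$ (i, i)\<bar>"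
proof -
  let ?e = "unit_vec m i"
  note c = basis_G1_carrier[of j] unit_vec_carrier[of m i]
  have eq: "form T ?e (basis_G1 j) = form T (basis_G1 j) ?e"
    using neg_def_lattice_form_commute[OF nd_T, of ?e "basis_G1 j"] c by simp
  have ee: "form T ?e ?e = T $$ (i, i)" using assms by (simp add: form_unit_unit[OF T])
  have "form T (basis_G1 j + ?e) (basis_G1 j + ?e) \<le> 0" "form T (basis_G1 j - ?e) (basis_G1 j - ?e) \<le> 0"
    using neg_def_lattice_nonpos[OF nd_T] c by simp_all
  then show ?thesis
    using c form_basis_G1_self[OF assms(1)]
    by (simp add: form_add_left[OF T] form_add_right[OF T] form_minus_left[OF T]
        form_minus_right[OF T] eq ee)
qed

text \<open>
  If \<open>e\<^sub>i\<close> is in the image of \<open>G1 \<oplus> L\<close> but not in that of \<open>L\<close>, then it is not orthogonal to some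
  \<open>basis_G1 j\<close>, that is, this vector has a nonzero \<open>i\<close>-th coordinate. A vector of norm \<open>G1 $$ (j, j)\<close>
  has at most \<open>\<bar>G1 $$ (j, j)\<bar>\<close> nonzero coordinates in the part \<open>\<langle>-1\<rangle>\<^sup>N\<close>.
\<close>

lemma missing_units_image_L_bound:
  "int (card {i \<in> {r..<m}. unit_vec m i \<notin> image_L}) \<le>
    int (card {i \<in> {r..<m}. unit_vec m i \<notin> image_S}) + (\<Sum>j<rk G1. \<bar>G1 $$ (j, j)\<bar>)"
proof -
  let ?A = "{i \<in> {r..<m}. unit_vec m i \<notin> image_L}"
  let ?B = "{i \<in> {r..<m}. unit_vec m i \<notin> image_S}"
  let ?C = "\<lambda>j. {i \<in> {r..<m}. basis_G1 j $ i \<noteq> 0}"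
  have "?A \<subseteq> ?B \<union> (\<Union>j<rk G1. ?C j)"
  proof
    fix i assume i: "i \<in> ?A"
    show "i \<in> ?B \<union> (\<Union>j<rk G1. ?C j)"
    proof (cases "unit_vec m i \<in> image_S")
      case True
      then obtain j where j: "j < rk G1" "form T (basis_G1 j) (unit_vec m i) \<noteq> 0"
        using i image_L_iff by auto
      then have "basis_G1 j $ i \<noteq> 0"
        using i form_unit_target[of i "basis_G1 j"] basis_G1_carrier[of j]
          neg_def_lattice_form_commute[OF nd_T, of "basis_G1 j" "unit_vec m i"] by simp
      then show ?thesis using i j(1) by auto
    qed (use i in auto)
  qed
  then have "card ?A \<le> card (?B \<union> (\<Union>j<rk G1. ?C j))" by (intro card_mono) auto
  also have "\<dots> \<le> card ?B + (\<Sum>j<rk G1. card (?C j))"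
    using card_Un_le[of ?B "\<Union>j<rk G1. ?C j"] card_UN_le[of "{..<rk G1}" ?C] by simp
  finally have "int (card ?A) \<le> int (card ?B) + (\<Sum>j<rk G1. int (card (?C j)))"
    by (simp flip: of_nat_sum of_nat_add)
  also have "(\<Sum>j<rk G1. int (card (?C j))) \<le> (\<Sum>j<rk G1. \<bar>G1 $$ (j, j)\<bar>)"
  proof (rule sum_mono)
    fix j assume "j \<in> {..<rk G1}"
    then have j: "j < rk G1" by simp
    have "int (card (?C j)) = (\<Sum>i\<in>?C j. 1)" by simp
    also have "\<dots> \<le> (\<Sum>i\<in>?C j. basis_G1 j $ i * basis_G1 j $ i)"
      by (intro sum_mono) (auto simp: int_one_le_iff_zero_less zero_less_mult_iff)
    also have "\<dots> \<le> (\<Sum>i=r..<m. basis_G1 j $ i * basis_G1 j $ i)" by (intro sum_mono2) auto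
    also have "\<dots> = form G2 (vec_first (basis_G1 j) r) (vec_first (basis_G1 j) r) - G1 $$ (j, j)"
      using form_target[OF basis_G1_carrier basis_G1_carrier, of j j] form_basis_G1_self[OF j] by simp
    also have "\<dots> \<le> \<bar>G1 $$ (j, j)\<bar>"
      using neg_def_lattice_nonpos[OF G2, of "vec_first (basis_G1 j) r"] by simp
    finally show "int (card (?C j)) \<le> \<bar>G1 $$ (j, j)\<bar>" .
  qed
  finally show ?thesis by simp
qed

end

section \<open>Stable classes from images\<close>

text \<open>
  From here on target vectors are functions \<open>nat \<Rightarrow> int\<close> that vanish from some index on, so that targets
  of different rank share one type and stabilisation only adds further coordinates.
\<close>

definition trunc :: "nat \<Rightarrow> (nat \<Rightarrow> int) \<Rightarrow> nat \<Rightarrow> int" where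
  "trunc n x = (\<lambda>i. if i < n then x i else 0)"

definition tail_form :: "int mat \<Rightarrow> nat \<Rightarrow> (nat \<Rightarrow> int) \<Rightarrow> (nat \<Rightarrow> int) \<Rightarrow> int" where
  "tail_form G k x y = form G (vec (rk G) x) (vec (rk G) y) - (\<Sum>i=rk G..<k. x i * y i)"

text \<open>
  \<open>L\<close> embeds with image \<open>X\<close> plus all coordinate vectors from \<open>n\<close> up to some \<open>m\<close>. The rank \<open>m\<close> is
  quantified away because it depends on \<open>L\<close> and is not bounded, while \<open>n\<close> and \<open>X\<close> will range over a finite
  set.
\<close>

definition stable_image :: "int mat \<Rightarrow> int mat \<Rightarrow> nat \<Rightarrow> (nat \<Rightarrow> int) set \<Rightarrow> bool" where
  "stable_image G L n X \<longleftrightarrow> (\<exists>m F. rk G \<le> n \<and> n \<le> m \<and>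
     (\<forall>x\<in>lattice_group L. \<forall>y\<in>lattice_group L. F (x + y) = F x + F y) \<and>
     (\<forall>x\<in>lattice_group L. \<forall>y\<in>lattice_group L. tail_form G m (F x) (F y) = form L x y) \<and>
     F ` lattice_group L = {z. trunc m z = z \<and> trunc n z \<in> X})"

lemma inj_on_of_form:
  assumes A: "neg_def_lattice A"
    and form: "\<And>x y. x \<in> lattice_group A \<Longrightarrow> y \<in> lattice_group A \<Longrightarrow> q (h x) (h y) = form A x y"
  shows "inj_on h (lattice_group A)"
proof (rule inj_onI)
  fix x y assume xy: "x \<in> lattice_group A" "y \<in> lattice_group A" "h x = h y"
  note Ac = neg_def_lattice_carrier[OF A]
  have "form A x z = form A y z" if "z \<in> lattice_group A" for z
    using form[OF xy(1) that] form[OF xy(2) that] xy(3) by simp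
  then have "form A (x - y) (x - y) = 0"
    using xy by (simp add: form_minus_left[OF Ac])
  then have "x - y = 0\<^sub>v (rk A)" using xy by (intro neg_def_lattice_form_eq_0[OF A]) simp_all
  then have "(x - y) $ i = 0" if "i < rk A" for i using that by simp
  then show "x = y" using xy by (intro eq_vecI) auto
qed

text \<open>
  Extends an embedding \<open>F\<close> of a lattice of rank \<open>l\<close> into the first \<open>m\<close> coordinates by sending the
  summand \<open>\<langle>-1\<rangle>\<^sup>k\<close> to the next \<open>k\<close> coordinates.
\<close>

definition glue :: "nat \<Rightarrow> nat \<Rightarrow> (int vec \<Rightarrow> nat \<Rightarrow> int) \<Rightarrow> nat \<Rightarrow> int vec \<Rightarrow> nat \<Rightarrow> int" where
  "glue l k F m x = (\<lambda>i. if i < m then F (vec_first x l) i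
     else if i < m + k then x $ (l + (i - m)) else 0)"

lemma glue_properties:
  fixes k :: nat
  assumes L: "neg_def_lattice L" and n: "rk G \<le> n" "n \<le> m"
    and add: "\<forall>x\<in>lattice_group L. \<forall>y\<in>lattice_group L. F (x + y) = F x + F y"
    and form: "\<forall>x\<in>lattice_group L. \<forall>y\<in>lattice_group L. tail_form G m (F x) (F y) = form L x y"
    and image: "F ` lattice_group L = {z. trunc m z = z \<and> trunc n z \<in> X}"
  defines "S \<equiv> L \<oplus>\<^sub>L neg_one_pow k" and "h \<equiv> glue (rk L) k F m"
  shows "x \<in> lattice_group S \<Longrightarrow> y \<in> lattice_group S \<Longrightarrow> h (x + y) = h x + h y"
    and "x \<in> lattice_group S \<Longrightarrow> y \<in> lattice_group S \<Longrightarrow> tail_form G (m + k) (h x) (h y) = form S x y"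
    and "h ` lattice_group S = {z. trunc (m + k) z = z \<and> trunc n z \<in> X}"
proof -
  let ?l = "rk L"
  note Lc = neg_def_lattice_carrier[OF L]
  have S: "lattice_group S = carrier_vec (?l + k)" by (simp add: S_def)
  {
    assume xy: "x \<in> lattice_group S" "y \<in> lattice_group S"
    have "vec_first (x + y) ?l = vec_first x ?l + vec_first y ?l"
      using xy by (auto simp: S vec_first_def)
    then show "h (x + y) = h x + h y"
      using xy add by (auto simp: h_def glue_def S fun_eq_iff)
  next
    assume xy: "x \<in> lattice_group S" "y \<in> lattice_group S"
    have vec_h: "vec (rk G) (h x) = vec (rk G) (F (vec_first x ?l))" for x
      using n by (auto simp: h_def glue_def)
    have "(\<Sum>i=rk G..<m + k. h x i * h y i) = (\<Sum>i=rk G..<m. h x i * h y i) + (\<Sum>i=m..<m + k. h x i * h y i)"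
      using n by (simp add: sum.atLeastLessThan_concat)
    also have "(\<Sum>i=rk G..<m. h x i * h y i)
        = (\<Sum>i=rk G..<m. F (vec_first x ?l) i * F (vec_first y ?l) i)"
      by (intro sum.cong) (auto simp: h_def glue_def)
    also have "(\<Sum>i=m..<m + k. h x i * h y i) = (\<Sum>i<k. h x (i + m) * h y (i + m))"
      using sum.shift_bounds_nat_ivl[of "\<lambda>i. h x i * h y i" 0 m k]
      by (simp add: lessThan_atLeast0 add.commute)
    also have "\<dots> = vec_last x k \<bullet> vec_last y k"
      using xy by (auto simp: S scalar_prod_def vec_last_def lessThan_atLeast0 h_def glue_def
          intro!: sum.cong)
    finally have "tail_form G (m + k) (h x) (h y)
        = tail_form G m (F (vec_first x ?l)) (F (vec_first y ?l)) - vec_last x k \<bullet> vec_last y k"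
      by (simp add: tail_form_def vec_h)
    also have "\<dots> = form L (vec_first x ?l) (vec_first y ?l)
        + form (neg_one_pow k) (vec_last x k) (vec_last y k)"
      using form by (simp add: form_neg_one_pow)
    also have "\<dots> = form S (vec_first x ?l @\<^sub>v vec_last x k) (vec_first y ?l @\<^sub>v vec_last y k)"
      unfolding S_def by (rule form_append[symmetric]) (use Lc in auto)
    finally show "tail_form G (m + k) (h x) (h y) = form S x y"
      using xy by (simp add: S)
  next
    show "h ` lattice_group S = {z. trunc (m + k) z = z \<and> trunc n z \<in> X}"
    proof (intro equalityI subsetI)
      fix z assume "z \<in> h ` lattice_group S"
      then obtain x where x: "x \<in> lattice_group S" "z = h x" by blast
      have "F (vec_first x ?l) \<in> F ` lattice_group L" by simp
      then have "trunc n (F (vec_first x ?l)) \<in> X" unfolding image by blast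
      moreover have "trunc n z = trunc n (F (vec_first x ?l))"
        using n by (auto simp: x h_def glue_def trunc_def)
      moreover have "trunc (m + k) z = z" by (auto simp: x h_def glue_def trunc_def)
      ultimately show "z \<in> {z. trunc (m + k) z = z \<and> trunc n z \<in> X}" by simp
    next
      fix z assume z: "z \<in> {z. trunc (m + k) z = z \<and> trunc n z \<in> X}"
      have "trunc m (trunc m z) = trunc m z" "trunc n (trunc m z) = trunc n z"
        using n by (auto simp: trunc_def)
      then have "trunc m z \<in> F ` lattice_group L" using z unfolding image by simp
      then obtain v where v: "v \<in> lattice_group L" "F v = trunc m z" by force
      let ?x = "v @\<^sub>v vec k (\<lambda>i. z (m + i))"
      have "vec_first ?x ?l = v" using v by (auto simp: vec_first_def)
      moreover have "?x $ (?l + (i - m)) = z i" if "\<not> i < m" "i < m + k" for i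
        using that v by auto
      moreover have "z i = 0" if "\<not> i < m + k" for i
        using z that by (metis (mono_tags, lifting) mem_Collect_eq trunc_def)
      ultimately have "h ?x = z" using v(2) by (auto simp: h_def glue_def trunc_def fun_eq_iff)
      moreover have "?x \<in> lattice_group S" using v by (simp add: S)
      ultimately show "z \<in> h ` lattice_group S" by (metis imageI)
    qed
  }
qed

text \<open>
  If the two lattices occupy \<open>m\<close> and \<open>m'\<close> coordinates, adding \<open>m' - n\<close> and \<open>m - n\<close> copies of
  \<open>\<langle>-1\<rangle>\<close> respectively gives both of them the same image, namely \<open>X\<close> and all coordinate vectors from
  \<open>n\<close> to \<open>m + m' - n\<close>.
\<close>

lemma stable_image_imp_stable_equiv:
  assumes L: "neg_def_lattice L" "neg_def_lattice L'"
    and "stable_image G L n X" "stable_image G L' n X"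
  shows "(L, L') \<in> stable_equiv"
proof -
  obtain m F where F: "rk G \<le> n" "n \<le> m"
     "\<forall>x\<in>lattice_group L. \<forall>y\<in>lattice_group L. F (x + y) = F x + F y"
     "\<forall>x\<in>lattice_group L. \<forall>y\<in>lattice_group L. tail_form G m (F x) (F y) = form L x y"
     "F ` lattice_group L = {z. trunc m z = z \<and> trunc n z \<in> X}"
    using assms(3) unfolding stable_image_def by blast
  obtain m' F' where F': "rk G \<le> n" "n \<le> m'"
     "\<forall>x\<in>lattice_group L'. \<forall>y\<in>lattice_group L'. F' (x + y) = F' x + F' y"
     "\<forall>x\<in>lattice_group L'. \<forall>y\<in>lattice_group L'. tail_form G m' (F' x) (F' y) = form L' x y"
     "F' ` lattice_group L' = {z. trunc m' z = z \<and> trunc n z \<in> X}"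
    using assms(4) unfolding stable_image_def by blast
  note h = glue_properties[OF L(1) F, where k = "m' - n"]
  note h' = glue_properties[OF L(2) F', where k = "m - n"]
  have m: "m' + (m - n) = m + (m' - n)" using F(2) F'(2) by simp
  have nd: "neg_def_lattice (L \<oplus>\<^sub>L neg_one_pow (m' - n))" "neg_def_lattice (L' \<oplus>\<^sub>L neg_one_pow (m - n))"
    by (intro neg_def_lattice_sum L neg_def_lattice_neg_one_pow)+
  have "isometric (L \<oplus>\<^sub>L neg_one_pow (m' - n)) (L' \<oplus>\<^sub>L neg_one_pow (m - n))"
  proof (rule isometricI_common_image[where q = "tail_form G (m + (m' - n))"])
    show "inj_on (glue (rk L) (m' - n) F m) (lattice_group (L \<oplus>\<^sub>L neg_one_pow (m' - n)))"
      by (rule inj_on_of_form[OF nd(1), where q = "tail_form G (m + (m' - n))"]) (rule h(2))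
    show "inj_on (glue (rk L') (m - n) F' m') (lattice_group (L' \<oplus>\<^sub>L neg_one_pow (m - n)))"
      by (rule inj_on_of_form[OF nd(2), where q = "tail_form G (m' + (m - n))"]) (rule h'(2))
    show "glue (rk L) (m' - n) F m ` lattice_group (L \<oplus>\<^sub>L neg_one_pow (m' - n)) =
        glue (rk L') (m - n) F' m' ` lattice_group (L' \<oplus>\<^sub>L neg_one_pow (m - n))"
      unfolding h(3) h'(3) m ..
  qed (fact h(1,2) h'(1,2)[unfolded m])+
  then show ?thesis using L by (auto simp: stable_equiv_def)
qed

section \<open>Finitely many images\<close>

text \<open>
  The shape of all images: \<open>c\<close> holds the pairings of the first \<open>n\<close> coordinate vectors with the images of
  the \<open>g\<close> basis vectors of \<open>\<Gamma>\<^sub>1\<close>, and \<open>R\<close> the residues modulo \<open>d\<close> of the vectors in the image of the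
  whole sum.
\<close>

definition cong_orth_set :: "int \<Rightarrow> nat \<Rightarrow> nat \<Rightarrow> (nat \<times> nat \<Rightarrow> int) \<Rightarrow> (nat \<Rightarrow> int) set \<Rightarrow> (nat \<Rightarrow> int) set" where
  "cong_orth_set d g n c R =
     {x. trunc n x = x \<and> (\<forall>j<g. (\<Sum>i<n. c (j, i) * x i) = 0) \<and> (\<lambda>i. x i mod d) \<in> R}"

definition cong_orth_sets :: "int \<Rightarrow> nat \<Rightarrow> nat \<Rightarrow> int \<Rightarrow> (nat \<Rightarrow> int) set set" where
  "cong_orth_sets d g n K = {cong_orth_set d g n c R | c R.
     (\<forall>p. (p \<in> {..<g} \<times> {..<n} \<longrightarrow> c p \<in> {-K..K}) \<and> (p \<notin> {..<g} \<times> {..<n} \<longrightarrow> c p = 0)) \<and>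
     R \<subseteq> {f. \<forall>i. (i \<in> {..<n} \<longrightarrow> f i \<in> {0..<d}) \<and> (i \<notin> {..<n} \<longrightarrow> f i = 0)}}"

lemma finite_cong_orth_sets: "finite (cong_orth_sets d g n K)"
proof -
  let ?C = "{c :: nat \<times> nat \<Rightarrow> int. \<forall>p. (p \<in> {..<g} \<times> {..<n} \<longrightarrow> c p \<in> {-K..K}) \<and>
    (p \<notin> {..<g} \<times> {..<n} \<longrightarrow> c p = 0)}"
  let ?R = "{f :: nat \<Rightarrow> int. \<forall>i. (i \<in> {..<n} \<longrightarrow> f i \<in> {0..<d}) \<and> (i \<notin> {..<n} \<longrightarrow> f i = 0)}"
  have "finite ?C" "finite ?R" by (intro finite_set_of_finite_funs; simp)+
  then have "finite ((\<lambda>(c, R). cong_orth_set d g n c R) ` (?C \<times> Pow ?R))" by simp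
  moreover have "cong_orth_sets d g n K \<subseteq> (\<lambda>(c, R). cong_orth_set d g n c R) ` (?C \<times> Pow ?R)"
    unfolding cong_orth_sets_def by force
  ultimately show ?thesis by (rule finite_subset[rotated])
qed

lemma permutation_collecting_subset:
  assumes "I \<subseteq> {r..<m}" "r \<le> m"
  shows "\<exists>\<pi> :: nat \<Rightarrow> nat. (\<forall>i<r. \<pi> i = i) \<and> bij_betw \<pi> {r..<m} {r..<m} \<and>
    \<pi> ` {r..<r + card I} = I \<and> r + card I \<le> m"
proof -
  let ?n = "r + card I"
  have "finite I" using assms finite_subset by blast
  have "card I \<le> card {r..<m}" by (rule card_mono) (use assms in auto)
  then have n: "?n \<le> m" using assms by simp
  obtain f where f: "bij_betw f {r..<?n} I"
    using finite_same_card_bij[of "{r..<?n}" I] \<open>finite I\<close> by auto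
  have "card ({r..<m} - I) = m - ?n" using assms \<open>finite I\<close> by (simp add: card_Diff_subset)
  then obtain g where g: "bij_betw g {?n..<m} ({r..<m} - I)"
    using finite_same_card_bij[of "{?n..<m}" "{r..<m} - I"] by auto
  define \<pi> where "\<pi> i = (if i < r then i else if i < ?n then f i else g i)" for i
  have 1: "bij_betw \<pi> {r..<?n} I"
    using bij_betw_cong[of "{r..<?n}" \<pi> f] f by (simp add: \<pi>_def)
  have 2: "bij_betw \<pi> {?n..<m} ({r..<m} - I)"
    using bij_betw_cong[of "{?n..<m}" \<pi> g] g by (simp add: \<pi>_def)
  have "bij_betw \<pi> ({r..<?n} \<union> {?n..<m}) (I \<union> ({r..<m} - I))"
    by (rule bij_betw_combine[OF 1 2]) auto
  moreover have "{r..<?n} \<union> {?n..<m} = {r..<m}" "I \<union> ({r..<m} - I) = {r..<m}"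
    using n assms by auto
  ultimately have "bij_betw \<pi> {r..<m} {r..<m}" by simp
  moreover have "\<pi> i = i" if "i < r" for i using that by (simp add: \<pi>_def)
  ultimately show ?thesis using bij_betw_imp_surj_on[OF 1] n by blast
qed

context full_rank_embedding
begin

lemma form_eq_sum_unit:
  assumes "x \<in> carrier_vec m" "y \<in> carrier_vec m"
  shows "form T x y = (\<Sum>l<m. form T x (unit_vec m l) * y $ l)"
proof -
  have Tx: "T *\<^sub>v x \<in> carrier_vec m" by (rule mult_mat_vec_carrier[OF T assms(1)])
  have "form T x y = form T y x"
    using neg_def_lattice_form_commute[OF nd_T] assms by simp
  also have "\<dots> = (\<Sum>l<m. y $ l * (T *\<^sub>v x) $ l)"
    unfolding form_def scalar_prod_def using Tx by (simp only: lessThan_atLeast0 carrier_vecD)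
  also have "\<dots> = (\<Sum>l<m. form T x (unit_vec m l) * y $ l)"
  proof (rule sum.cong)
    fix l assume "l \<in> {..<m}"
    then have "(T *\<^sub>v x) $ l = form T x (unit_vec m l)"
      using form_unit_left[OF T _ assms(1)] neg_def_lattice_form_commute[OF nd_T, of x] assms(1)
      by simp
    then show "y $ l * (T *\<^sub>v x) $ l = form T x (unit_vec m l) * y $ l" by simp
  qed simp
  finally show ?thesis .
qed

text \<open>
  A permutation of the coordinates moves the coordinate vectors that the image of \<open>L\<close> misses to the
  positions \<open>r, ..., n - 1\<close>. The remaining ones lie in the image, so only the first \<open>n\<close> coordinates of
  a vector decide whether it belongs to the image. On these, orthogonality to the image of \<open>G1\<close> together
  with a congruence condition modulo \<open>d\<close> describes the image.
\<close>

lemma stable_image_exists: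
  assumes K: "\<And>i j. j < rk G1 \<Longrightarrow> i < m \<Longrightarrow> \<bar>G1 $$ (j, j)\<bar> + \<bar>T $$ (i, i)\<bar> \<le> K"
  defines "n \<equiv> r + card {i \<in> {r..<m}. unit_vec m i \<notin> image_L}"
  shows "\<exists>X \<in> cong_orth_sets d (rk G1) n K. stable_image G2 L n X"
proof -
  let ?I = "{i \<in> {r..<m}. unit_vec m i \<notin> image_L}"
  have sub: "?I \<subseteq> {r..<m}" by blast
  obtain \<pi> where \<pi>: "\<And>i. i < r \<Longrightarrow> \<pi> i = i" "bij_betw \<pi> {r..<m} {r..<m}"
      "\<pi> ` {r..<n} = ?I" "n \<le> m"
    using permutation_collecting_subset[OF sub le_add1, folded n_def] by blast
  have "bij_betw \<pi> {..<r} {..<r}" using bij_betw_cong[of "{..<r}" \<pi> id] \<pi>(1) by simp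
  then have "bij_betw \<pi> ({..<r} \<union> {r..<m}) ({..<r} \<union> {r..<m})"
    by (rule bij_betw_combine[OF _ \<pi>(2)]) auto
  moreover have "{..<r} \<union> {r..<m} = {..<m}" by auto
  ultimately have bij: "bij_betw \<pi> {..<m} {..<m}" by simp
  define \<rho> where "\<rho> = inv_into {..<m} \<pi>"
  have \<pi>_less: "\<pi> i < m" "\<rho> (\<pi> i) = i" if "i < m" for i
    using that bij bij_betw_imp_inj_on[OF bij] by (auto simp: \<rho>_def bij_betw_def)
  have \<rho>_less: "\<rho> l < m" "\<pi> (\<rho> l) = l" if "l < m" for l
    using that bij f_inv_into_f[of l \<pi> "{..<m}"] inv_into_into[of l \<pi> "{..<m}"]
    by (auto simp: \<rho>_def bij_betw_def)
  have rn: "r \<le> n" by (simp add: n_def)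
  have unit: "unit_vec m (\<pi> k) \<in> image_L" if k: "n \<le> k" "k < m" for k
  proof -
    have "\<pi> k \<in> {r..<m}" using k rn \<pi>(2) by (auto simp: bij_betw_def)
    moreover have "\<pi> k \<notin> ?I"
    proof
      assume "\<pi> k \<in> ?I"
      then obtain i where i: "i \<in> {r..<n}" "\<pi> i = \<pi> k" unfolding \<pi>(3)[symmetric] by auto
      then have "i = k" using \<pi>_less(2)[of i] \<pi>_less(2)[of k] k \<pi>(4) by simp
      then show False using i k by simp
    qed
    ultimately show ?thesis by blast
  qed
  \<comment> \<open>\<open>unperm\<close> turns a function in permuted coordinates back into a target vector.\<close>
  define unperm where "unperm x = vec m (\<lambda>l. x (\<rho> l))" for x :: "nat \<Rightarrow> int"
  have unperm: "unperm x \<in> carrier_vec m" for x by (simp add: unperm_def)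
  define F where "F v = (\<lambda>i. if i < m then (P *\<^sub>v incl v) $ \<pi> i else 0)" for v
  have F_add: "F (v + w) = F v + F w" if "v \<in> lattice_group L" "w \<in> lattice_group L" for v w
  proof -
    have "incl (v + w) = incl v + incl w" using that by (auto simp: vec_eq_iff)
    then have "P *\<^sub>v incl (v + w) = P *\<^sub>v incl v + P *\<^sub>v incl w"
      using mult_add_distrib_mat_vec[OF P incl[OF that(1)] incl[OF that(2)]] by simp
    then show ?thesis using carrier_matD[OF P] \<pi>_less by (auto simp: F_def fun_eq_iff)
  qed
  have F_form: "tail_form G2 m (F v) (F w) = form L v w"
    if v: "v \<in> lattice_group L" and w: "w \<in> lattice_group L" for v w
  proof -
    have first: "vec r (F v) = vec_first (P *\<^sub>v incl v) r" for v
      by (auto simp: F_def vec_first_def \<pi>(1))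
    have "(\<Sum>i=r..<m. F v i * F w i)
        = (\<Sum>i=r..<m. (P *\<^sub>v incl v) $ \<pi> i * (P *\<^sub>v incl w) $ \<pi> i)"
      by (simp add: F_def)
    also have "\<dots> = (\<Sum>i=r..<m. (P *\<^sub>v incl v) $ i * (P *\<^sub>v incl w) $ i)"
      by (rule sum.reindex_bij_betw[OF \<pi>(2)])
    finally show ?thesis
      unfolding tail_form_def first form_incl[OF v w, symmetric]
        form_target[OF P_vec[OF incl[OF v]] P_vec[OF incl[OF w]]] by simp
  qed
  have F_image: "F ` lattice_group L = {z. trunc m z = z \<and> unperm z \<in> image_L}"
  proof (intro equalityI subsetI)
    fix z assume "z \<in> F ` lattice_group L"
    then obtain v where v: "v \<in> lattice_group L" "z = F v" by blast
    have "unperm (F v) = P *\<^sub>v incl v"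
      using carrier_matD[OF P] \<rho>_less by (intro eq_vecI) (auto simp: unperm_def F_def)
    then show "z \<in> {z. trunc m z = z \<and> unperm z \<in> image_L}"
      using v by (auto simp: image_L_def trunc_def F_def)
  next
    fix z assume z: "z \<in> {z. trunc m z = z \<and> unperm z \<in> image_L}"
    then obtain v where v: "v \<in> lattice_group L" "unperm z = P *\<^sub>v incl v"
      by (auto simp: image_L_def)
    have "F v = trunc m z"
      unfolding F_def v(2)[symmetric] using \<pi>_less by (auto simp: unperm_def trunc_def)
    then show "z \<in> F ` lattice_group L" using v z by auto
  qed
  \<comment> \<open>Each coordinate at or beyond \<open>n\<close> can be cleared by a multiple of a coordinate vector in the image.\<close>
  have trunc_step: "unperm (trunc k z) \<in> image_L \<longleftrightarrow> unperm (trunc n z) \<in> image_L"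
    if "n \<le> k" "k \<le> m" for k z
    using that
  proof (induction k rule: nat_induct_at_least)
    case (Suc k)
    let ?e = "unit_vec m (\<pi> k)"
    have "unperm (trunc (Suc k) z) = unperm (trunc k z) + z k \<cdot>\<^sub>v ?e"
    proof (rule eq_vecI)
      fix l assume "l < dim_vec (unperm (trunc k z) + z k \<cdot>\<^sub>v ?e)"
      then have l: "l < m" by simp
      have "\<rho> l = k \<longleftrightarrow> l = \<pi> k" using l Suc.prems \<rho>_less \<pi>_less by force
      then show "unperm (trunc (Suc k) z) $ l = (unperm (trunc k z) + z k \<cdot>\<^sub>v ?e) $ l"
        using l Suc.prems \<pi>_less by (auto simp: unperm_def trunc_def unit_vec_def less_Suc_eq)
    qed (simp add: unperm_def)
    moreover from this have "unperm (trunc k z) = unperm (trunc (Suc k) z) + (- z k) \<cdot>\<^sub>v ?e"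
      using unperm[of "trunc k z"] by (auto simp: vec_eq_iff)
    moreover have "?e \<in> image_L" using unit[of k] Suc by simp
    ultimately have "unperm (trunc (Suc k) z) \<in> image_L \<longleftrightarrow> unperm (trunc k z) \<in> image_L"
      using image_L_comb by metis
    then show ?case using Suc by simp
  qed simp
  define X where "X = {x. trunc n x = x \<and> unperm x \<in> image_L}"
  have "F ` lattice_group L = {z. trunc m z = z \<and> trunc n z \<in> X}"
  proof -
    have "trunc n (trunc n z) = trunc n z" for z by (auto simp: trunc_def)
    then have "unperm z \<in> image_L \<longleftrightarrow> trunc n z \<in> X" if "trunc m z = z" for z
      using trunc_step[of m z] \<pi>(4) that by (simp add: X_def)
    then show ?thesis unfolding F_image by blast
  qed
  then have "stable_image G2 L n X"
    unfolding stable_image_def using F_add F_form rn \<pi>(4) by blast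
  moreover have "X \<in> cong_orth_sets d (rk G1) n K"
  proof -
    define c where "c p = (case p of (j, i) \<Rightarrow>
      if j < rk G1 \<and> i < n then form T (basis_G1 j) (unit_vec m (\<pi> i)) else 0)" for p
    define R where "R = {\<lambda>i. x i mod d | x. trunc n x = x \<and> unperm x \<in> image_S}"
    have zero: "x i = 0" if "trunc n x = x" "\<not> i < n" for x i
      using that by (metis trunc_def)
    have orth: "form T (basis_G1 j) (unperm x) = (\<Sum>i<n. c (j, i) * x i)"
      if j: "j < rk G1" and x: "trunc n x = x" for j x
    proof -
      have "form T (basis_G1 j) (unperm x) = (\<Sum>l<m. form T (basis_G1 j) (unit_vec m l) * unperm x $ l)"
        by (rule form_eq_sum_unit[OF basis_G1_carrier unperm])
      also have "\<dots> = (\<Sum>i<m. form T (basis_G1 j) (unit_vec m (\<pi> i)) * unperm x $ \<pi> i)"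
        by (rule sum.reindex_bij_betw[OF bij, symmetric])
      also have "\<dots> = (\<Sum>i<m. form T (basis_G1 j) (unit_vec m (\<pi> i)) * x i)"
        using \<pi>_less by (intro sum.cong) (auto simp: unperm_def)
      also have "\<dots> = (\<Sum>i<n. c (j, i) * x i)"
        using \<pi>(4) j zero[OF x] by (intro sum.mono_neutral_cong_right) (auto simp: c_def)
      finally show ?thesis .
    qed
    have cong: "unperm x \<in> image_S \<longleftrightarrow> (\<lambda>i. x i mod d) \<in> R" if x: "trunc n x = x" for x
    proof
      assume "(\<lambda>i. x i mod d) \<in> R"
      then obtain y where y: "(\<lambda>i. x i mod d) = (\<lambda>i. y i mod d)" "unperm y \<in> image_S"
        by (auto simp: R_def)
      have "d dvd unperm x $ l - unperm y $ l" if "l < m" for l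
        using that fun_cong[OF y(1), of "\<rho> l"] by (simp add: unperm_def mod_eq_dvd_iff)
      then show "unperm x \<in> image_S" by (rule image_S_congruent[OF y(2) unperm])
    qed (use x in \<open>auto simp: R_def\<close>)
    have "X = cong_orth_set d (rk G1) n c R"
    proof -
      have "unperm x \<in> image_L \<longleftrightarrow>
          (\<forall>j<rk G1. (\<Sum>i<n. c (j, i) * x i) = 0) \<and> (\<lambda>i. x i mod d) \<in> R"
        if x: "trunc n x = x" for x
        using image_L_iff[of "unperm x"] image_L_subset cong[OF x] orth[OF _ x] by auto
      then show ?thesis unfolding X_def cong_orth_set_def by blast
    qed
    moreover have "c p \<in> {-K..K}" if p: "p \<in> {..<rk G1} \<times> {..<n}" for p
    proof -
      obtain j i where ji: "p = (j, i)" "j < rk G1" "i < n" using p by auto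
      then have "\<pi> i < m" using \<pi>_less \<pi>(4) by simp
      then have "\<bar>c p\<bar> \<le> K"
        using form_basis_G1_unit_bound[OF ji(2), of "\<pi> i"] K[OF ji(2), of "\<pi> i"] ji by (simp add: c_def)
      then show ?thesis by (auto simp: abs_le_iff)
    qed
    moreover have "c p = 0" if "p \<notin> {..<rk G1} \<times> {..<n}" for p
      using that by (cases p) (auto simp: c_def)
    moreover have "R \<subseteq> {f. \<forall>i. (i \<in> {..<n} \<longrightarrow> f i \<in> {0..<d}) \<and> (i \<notin> {..<n} \<longrightarrow> f i = 0)}"
    proof
      fix f assume "f \<in> R"
      then obtain x where x: "f = (\<lambda>i. x i mod d)" "trunc n x = x" by (auto simp: R_def)
      have "x i mod d \<in> {0..<d}" for i
        using pos_mod_sign[OF d_pos] pos_mod_bound[OF d_pos] by simp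
      moreover have "x i mod d = 0" if "i \<notin> {..<n}" for i
        using zero[OF x(2), of i] that by simp
      ultimately show "f \<in> {f. \<forall>i. (i \<in> {..<n} \<longrightarrow> f i \<in> {0..<d}) \<and> (i \<notin> {..<n} \<longrightarrow> f i = 0)}"
        unfolding x(1) by blast
    qed
    ultimately show ?thesis unfolding cong_orth_sets_def by blast
  qed
  ultimately show ?thesis by blast
qed

end

text \<open>
  The columns of \<open>P\<close> are the images of the basis vectors, and the entries of the two Gram matrices are the
  values of the forms on these vectors.
\<close>

lemma embeds_imp_full_rank_embedding:
  assumes nd: "neg_def_lattice G1" "neg_def_lattice G2" "neg_def_lattice L"
    and rank: "rk G2 + N = rk G1 + rk L"
    and emb: "embeds (G1 \<oplus>\<^sub>L L) (G2 \<oplus>\<^sub>L neg_one_pow N)"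
  obtains P where "full_rank_embedding G1 G2 L P N"
proof -
  let ?m = "rk G2 + N" and ?T = "G2 \<oplus>\<^sub>L neg_one_pow N" and ?S = "G1 \<oplus>\<^sub>L L"
  obtain f where f: "form_hom ?S ?T f" using emb by (auto simp: embeds_def)
  have T: "?T \<in> carrier_mat ?m ?m"
    using lattice_sum_carrier[of G2 "neg_one_pow N"] neg_def_lattice_carrier[OF nd(2)] by simp
  have S: "?S \<in> carrier_mat ?m ?m"
    using lattice_sum_carrier[of G1 L] neg_def_lattice_carrier[OF nd(1)]
      neg_def_lattice_carrier[OF nd(3)] by (simp add: rank)
  have fe: "f (unit_vec ?m i) \<in> carrier_vec ?m" for i
    using f by (auto simp: form_hom_def rank)
  define P where "P = mat ?m ?m (\<lambda>(i, j). f (unit_vec ?m j) $ i)"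
  have P: "P \<in> carrier_mat ?m ?m" by (simp add: P_def)
  have Pe: "P *\<^sub>v unit_vec ?m j = f (unit_vec ?m j)" if "j < ?m" for j
    using that fe[of j] by (intro eq_vecI) (auto simp: P_def)
  have "transpose_mat P * (?T * P) = ?S"
  proof (rule eq_matI)
    fix i j assume "i < dim_row ?S" "j < dim_col ?S"
    then have ij: "i < ?m" "j < ?m" using S by auto
    have PTP: "transpose_mat P * (?T * P) \<in> carrier_mat ?m ?m" using P T by simp
    have "(transpose_mat P * (?T * P)) $$ (i, j) = form ?T (P *\<^sub>v unit_vec ?m i) (P *\<^sub>v unit_vec ?m j)"
      using ij form_unit_unit[OF PTP] by (simp add: form_congruence[OF T P])
    also have "\<dots> = form ?S (unit_vec ?m i) (unit_vec ?m j)"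
      using f ij unfolding Pe[OF ij(1)] Pe[OF ij(2)] by (simp add: form_hom_def rank)
    finally show "(transpose_mat P * (?T * P)) $$ (i, j) = ?S $$ (i, j)"
      using ij by (simp add: form_unit_unit[OF S])
  qed (use S P in auto)
  then have "full_rank_embedding G1 G2 L P N"
    using nd rank P by unfold_locales
  then show thesis by (rule that)
qed

theorem theorem1p6:
  fixes \<Gamma>\<^sub>1 \<Gamma>\<^sub>2 :: "int mat" and C :: real and D :: int
  assumes "neg_def_lattice \<Gamma>\<^sub>1" and "neg_def_lattice \<Gamma>\<^sub>2" and "C > 0"
  shows "finite (lattice_classes \<Gamma>\<^sub>1 \<Gamma>\<^sub>2 C D)"
proof -
  let ?r = "rk \<Gamma>\<^sub>2" and ?g = "rk \<Gamma>\<^sub>1" and ?d = "\<bar>det \<Gamma>\<^sub>1 * D\<bar>"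
  define S where "S = {L. neg_def_lattice L \<and> det L = D \<and> delta L \<le> C \<and>
    (\<exists>N. ?r + N = ?g + rk L \<and> embeds (\<Gamma>\<^sub>1 \<oplus>\<^sub>L L) (\<Gamma>\<^sub>2 \<oplus>\<^sub>L neg_one_pow N))}"
  let ?A = "\<Sum>i<?r. \<Sum>j<?r. \<bar>adj_mat \<Gamma>\<^sub>2 $$ (i, j)\<bar>"
  let ?K1 = "\<Sum>j<?g. \<bar>\<Gamma>\<^sub>1 $$ (j, j)\<bar>" and ?K2 = "\<Sum>i<?r. \<bar>\<Gamma>\<^sub>2 $$ (i, i)\<bar>"
  \<comment> \<open>The bound on \<open>b\<close>: twice \<open>d\<close> times the possible gain in norm, plus the coordinates met by \<open>\<Gamma>\<^sub>1\<close>.\<close>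
  define B where "B = nat \<lfloor>2 * real_of_int ?d * (real_of_int ?A + real ?g + 4 * C) + real_of_int ?K1\<rfloor>"
  define Fam where "Fam = (\<Union>b\<le>B. {?r + b} \<times> cong_orth_sets ?d ?g (?r + b) (?K1 + ?K2 + 1))"
  have "\<exists>p\<in>Fam. stable_image \<Gamma>\<^sub>2 L (fst p) (snd p)" if LS: "L \<in> S" for L
  proof -
    obtain N where hL: "neg_def_lattice L" "det L = D" "delta L \<le> C"
      and N: "?r + N = ?g + rk L" "embeds (\<Gamma>\<^sub>1 \<oplus>\<^sub>L L) (\<Gamma>\<^sub>2 \<oplus>\<^sub>L neg_one_pow N)"
      using LS by (auto simp: S_def)
    obtain P where "full_rank_embedding \<Gamma>\<^sub>1 \<Gamma>\<^sub>2 L P N"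
      by (rule embeds_imp_full_rank_embedding[OF assms(1,2) hL(1) N])
    then interpret full_rank_embedding \<Gamma>\<^sub>1 \<Gamma>\<^sub>2 L P N .
    let ?b = "card {i \<in> {?r..<m}. unit_vec m i \<notin> image_L}"
    let ?s = "card {i \<in> {?r..<m}. unit_vec m i \<notin> image_S}"
    have "real_of_int (int ?b) \<le> real_of_int (int ?s + ?K1)"
      using missing_units_image_L_bound by (simp only: of_int_le_iff)
    then have "real ?b \<le> real ?s + real_of_int ?K1" by simp
    also have "real ?s \<le> 2 * real_of_int ?d * (real_of_int ?A + real ?g + 4 * delta L)"
      using missing_units_image_S_bound unfolding hL(2) .
    also have "\<dots> \<le> 2 * real_of_int ?d * (real_of_int ?A + real ?g + 4 * C)"
      using hL(3) by (intro mult_left_mono) simp_all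
    finally have "int ?b \<le> \<lfloor>2 * real_of_int ?d * (real_of_int ?A + real ?g + 4 * C) + real_of_int ?K1\<rfloor>"
      by (simp add: le_floor_iff)
    then have "?b \<le> B" unfolding B_def by linarith
    have "\<bar>\<Gamma>\<^sub>1 $$ (j, j)\<bar> + \<bar>T $$ (i, i)\<bar> \<le> ?K1 + ?K2 + 1" if "j < ?g" "i < m" for i j
    proof -
      have 1: "\<bar>\<Gamma>\<^sub>1 $$ (j, j)\<bar> \<le> ?K1" using that by (intro member_le_sum) auto
      show ?thesis
      proof (cases "i < ?r")
        case True
        then have "T $$ (i, i) = \<Gamma>\<^sub>2 $$ (i, i)"
          using carrier_matD[OF neg_def_lattice_carrier[OF assms(2)]] by (simp add: lattice_sum_def)
        moreover have "\<bar>\<Gamma>\<^sub>2 $$ (i, i)\<bar> \<le> ?K2" using True by (intro member_le_sum) auto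
        ultimately show ?thesis using 1 by simp
      next
        case False
        have "0 \<le> ?K2" by (rule sum_nonneg) simp
        moreover have "\<bar>T $$ (i, i)\<bar> = 1" using False that by (simp add: T_index)
        ultimately show ?thesis using 1 by linarith
      qed
    qed
    then obtain X where "X \<in> cong_orth_sets ?d ?g (?r + ?b) (?K1 + ?K2 + 1)"
      "stable_image \<Gamma>\<^sub>2 L (?r + ?b) X"
      using stable_image_exists unfolding hL(2) by blast
    with \<open>?b \<le> B\<close> show ?thesis unfolding Fam_def by force
  qed
  then obtain key where key: "\<And>L. L \<in> S \<Longrightarrow> key L \<in> Fam"
    "\<And>L. L \<in> S \<Longrightarrow> stable_image \<Gamma>\<^sub>2 L (fst (key L)) (snd (key L))" by metis
  have "finite Fam" unfolding Fam_def by (simp add: finite_cong_orth_sets)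
  have "S // stable_equiv \<subseteq> (\<lambda>p. stable_equiv `` {SOME L. L \<in> S \<and> key L = p}) ` Fam"
  proof
    fix c assume "c \<in> S // stable_equiv"
    then obtain L where L: "L \<in> S" "c = stable_equiv `` {L}" by (rule quotientE)
    define L' where "L' = (SOME L'. L' \<in> S \<and> key L' = key L)"
    have L': "L' \<in> S" "key L' = key L"
      using someI[of "\<lambda>L'. L' \<in> S \<and> key L' = key L" L] L(1) by (auto simp: L'_def)
    have "(L, L') \<in> stable_equiv"
      using stable_image_imp_stable_equiv[OF _ _ key(2)[OF L(1)]] key(2)[OF L'(1)] L L'
      by (simp add: S_def)
    then have "c = stable_equiv `` {L'}" using stable_equiv_class_eq L(2) by simp
    then show "c \<in> (\<lambda>p. stable_equiv `` {SOME L. L \<in> S \<and> key L = p}) ` Fam"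
      using key(1)[OF L(1)] by (auto simp: L'_def)
  qed
  then have "finite (S // stable_equiv)"
    using \<open>finite Fam\<close> by (meson finite_imageI finite_subset)
  then show ?thesis by (simp add: lattice_classes_def S_def)
qed

end
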